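(* Let $0<p<\infty$, $0<q,r\le\infty$, and let $b\in SV(0,1)$ satisfy $\|t^{-1/r}b(t)\|_{r,(0,1)}=\infty$. Let $0<W<\infty$, $0<U<\infty$, $0<V\le\infty$. Then: (i) $\|f\|_{L_b^{(p,q,r}}\sim\|H^{(U,W)}f\|_{B_b^{(p,q,r}}$ for all $f\in\mathfrak M(0,1)$ if and only if $p>U$. (ii) $\|f\|_{L_b^{(p,q,r}}\sim\|H_{(V,W)}f\|_{B_b^{(p,q,r}}$ for all $f\in\mathfrak M(0,1)$ if and only if $p<V$.
   Context: Conventions: $1/\infty=0$. $\mathfrak M(0,1)$ is the set of complex-valued Lebesgue measurable a.e. finite functions on $(0,1)$ (identified if equal a.e.). For $0<q\le\infty$, $\|\cdot\|_{q,(a,b)}$ is the usual Lebesgue (quasi-)norm on the interval $(a,b)$ (essential supremum if $q=\infty$). $f^*(t)=\inf\{\lambda>0:\ |\{x\in(0,1):|f(x)|>\lambda\}|\le t\}$ is the non-increasing rearrangement. $F\sim G$ means $c\,G\le F\le C\,G$ with constants $0<c\le C<\infty$ independent of $f$ (both sides may be $\infty$). $SV(0,1)$: positive measurable $b$ on $(0,1)$ such that for every $\varepsilon>0$ the function $t^{\varepsilon}b(t)$ is equivalent ($\sim$, pointwise with constants) to a non-decreasing function and $t^{-\varepsilon}b(t)$ is equivalent to a non-increasing function. For measurable $g$ on $(0,1)$ (possibly with value $\infty$), $$\|g\|_{B_b^{(p,q,r}}=\Big\|t^{-\frac1r}b(t)\big\|u^{\frac1p-\frac1q}|g(u)|\big\|_{q,(0,t)}\Big\|_{r,(0,1)},$$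 and the small Lorentz space $L_b^{(p,q,r}$ is the set of $f\in\mathfrak M(0,1)$ with $\|f\|_{L_b^{(p,q,r}}:=\|f^*\|_{B_b^{(p,q,r}}<\infty$. (The unbalanced parenthesis in "$(p,q,r$" is part of the notation.) Averaging operators, for $f\in\mathfrak M(0,1)$, $t\in(0,1)$: $$(H^{(U,W)}f)(t)=t^{-1/U}\big\|v^{\frac1U-\frac1W}f^*(v)\big\|_{W,(0,t)},\qquad (H_{(V,W)}f)(t)=t^{-1/V}\big\|v^{\frac1V-\frac1W}f^*(v)\big\|_{W,(t,1)}.$$ *)

theory Defs
  imports "HOL-Analysis.Analysis" "HOL-Probability.Essential_Supremum"
begin

text \<open>
  Norms and rearrangements take values in \<^typ>\<open>ennreal\<close>, since both sides of an equivalence may be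
  infinite. The exponents \<open>p, q, r, U, V, W\<close> are of type \<^typ>\<open>ennreal\<close> as well, because some of
  them may be \<open>\<infinity>\<close>; their reciprocals are real, with \<open>1 / \<infinity> = 0\<close>.
\<close>

abbreviation recip :: "ennreal \<Rightarrow> real"
  where "recip q \<equiv> enn2real (1 / q)"

text \<open>Only used for exponents \<open>a > 0\<close>.\<close>

definition epowr :: "ennreal \<Rightarrow> real \<Rightarrow> ennreal"
  where "epowr x a = (if x = \<infinity> then \<infinity> else ennreal (enn2real x powr a))"

definition Lnorm :: "ennreal \<Rightarrow> real \<Rightarrow> real \<Rightarrow> (real \<Rightarrow> ennreal) \<Rightarrow> ennreal"
  where "Lnorm q a b g =
    (if q = \<infinity> then esssup (lebesgue_on {a<..<b}) g
     else epowr (\<integral>\<^sup>+ x. epowr (g x) (enn2real q) \<partial>lebesgue_on {a<..<b}) (recip q))"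

text \<open>
  Functions are not identified up to null sets; this is harmless because they enter the norms and
  averaging operators only through their rearrangement. Every almost everywhere finite function has
  a representative with values in \<^typ>\<open>complex\<close>.
\<close>

definition M01 :: "(real \<Rightarrow> complex) set"
  where "M01 = borel_measurable (lebesgue_on {0<..<1})"

definition rearr :: "(real \<Rightarrow> complex) \<Rightarrow> real \<Rightarrow> ennreal"
  where "rearr f t = Inf (ennreal `
    {s. 0 < s \<and> emeasure lebesgue {x \<in> {0<..<1}. cmod (f x) > s} \<le> ennreal t})"

definition equiv_on :: "'a set \<Rightarrow> ('a \<Rightarrow> ennreal) \<Rightarrow> ('a \<Rightarrow> ennreal) \<Rightarrow> bool"
  where "equiv_on A F G \<longleftrightarrow>
    (\<exists>c C::real. 0 < c \<and> c \<le> C \<and>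
      (\<forall>x\<in>A. ennreal c * G x \<le> F x \<and> F x \<le> ennreal C * G x))"

text \<open>
  The monotone functions \<open>\<phi>\<close> below are automatically positive and finite on \<open>(0,1)\<close>, being
  equivalent to positive real-valued functions.
\<close>

definition SV01 :: "(real \<Rightarrow> real) set"
  where "SV01 = {b. b \<in> borel_measurable (lebesgue_on {0<..<1}) \<and> (\<forall>t\<in>{0<..<1}. 0 < b t) \<and>
    (\<forall>\<epsilon>>0.
      (\<exists>\<phi>. mono_on {0<..<1} \<phi> \<and> equiv_on {0<..<1} (\<lambda>t. ennreal (t powr \<epsilon> * b t)) \<phi>) \<and>
      (\<exists>\<phi>. antimono_on {0<..<1} \<phi> \<and> equiv_on {0<..<1} (\<lambda>t. ennreal (t powr (- \<epsilon>) * b t)) \<phi>))}"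

definition Bnorm :: "(real \<Rightarrow> real) \<Rightarrow> ennreal \<Rightarrow> ennreal \<Rightarrow> ennreal \<Rightarrow> (real \<Rightarrow> ennreal) \<Rightarrow> ennreal"
  where "Bnorm b p q r g =
    Lnorm r 0 1 (\<lambda>t. ennreal (t powr (- recip r) * b t) *
      Lnorm q 0 t (\<lambda>u. ennreal (u powr (recip p - recip q)) * g u))"

definition small_Lorentz_norm ::
    "(real \<Rightarrow> real) \<Rightarrow> ennreal \<Rightarrow> ennreal \<Rightarrow> ennreal \<Rightarrow> (real \<Rightarrow> complex) \<Rightarrow> ennreal"
  where "small_Lorentz_norm b p q r f = Bnorm b p q r (rearr f)"

definition H_upper :: "ennreal \<Rightarrow> ennreal \<Rightarrow> (real \<Rightarrow> complex) \<Rightarrow> real \<Rightarrow> ennreal"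
  where "H_upper U W f t = ennreal (t powr (- recip U)) *
    Lnorm W 0 t (\<lambda>v. ennreal (v powr (recip U - recip W)) * rearr f v)"

definition H_lower :: "ennreal \<Rightarrow> ennreal \<Rightarrow> (real \<Rightarrow> complex) \<Rightarrow> real \<Rightarrow> ennreal"
  where "H_lower V W f t = ennreal (t powr (- recip V)) *
    Lnorm W t 1 (\<lambda>v. ennreal (v powr (recip V - recip W)) * rearr f v)"

end

theory Submission
  imports Defs
begin

text \<open>
  Throughout, \<open>h = f\<^sup>*\<close>. A non-increasing \<open>h\<close> satisfies \<open>v\<^sup>a h(v) \<lesssim> \<parallel>w\<^bsup>a-1/q\<^esup> h(w)\<parallel>\<^bsub>q,(v/2,v)\<^esub>\<close>
  for every \<open>q\<close>, so at the price of a small change of the power the inner exponent \<open>W\<close> of an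
  averaging operator can be replaced pointwise by any other exponent. With inner exponent \<open>q\<close> the
  averages are bounded by Tonelli's theorem, which gives (i) if \<open>p > U\<close>. In (ii) the average over
  \<open>(t,1)\<close> is controlled through \<open>G(v) = v\<^bsup>-1/p\<^esup> \<parallel>w\<^bsup>1/p-1/q\<^esup> h(w)\<parallel>\<^bsub>q,(0,v)\<^esub>\<close>, which dominates
  \<open>h\<close> and is again non-increasing, so that \<open>q\<close> can be traded for \<open>r\<close> and Tonelli's theorem applies
  to the outer norm, where slow variation of \<open>b\<close> enters.

  If \<open>p \<le> U\<close>, the powers \<open>u\<^bsup>\<kappa>-1/U\<^esup>\<close> are eigenfunctions of \<open>H\<^bsup>(U,W)\<^esup>\<close> whose eigenvalues
  \<open>(\<kappa> W)\<^bsup>-1/W\<^esup>\<close> are unbounded as \<open>\<kappa> \<rightarrow> 0\<close>. If \<open>p \<ge> V\<close>, the constant function \<open>1\<close> has finite norm,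
  while the inner norm of its image under the averaging operator is bounded below on \<open>(0,1)\<close>, so that
  the outer norm diverges.
\<close>

section \<open>Lebesgue quasi-norms on intervals\<close>

text \<open>When the inner and the outer exponent of a Hardy inequality agree, raising to that power
  makes it a linear statement about a double integral, valid for all finite exponents alike. This is
  why each inner exponent is first traded for the one outside it. The strict inequality between p
  and U or V pays for this: every trade needs a strictly different power, and every Hardy inequality
  a further positive gap. Hence one intermediate power between 1/p and 1/U in (i), and two between
  1/V and 1/p in (ii), where W is traded for q and then q for r. The converse estimates need no gap,
  since one dyadic block of the average already dominates h. The average over (t,1) sees only points
  to the right of t, so it dominates h(2t), and a dilation has to be absorbed. In the counterexample
  to (i) the parameter \<open>\<kappa>\<close> stays positive, which keeps the power strictly below
  1/p even if p = U, so its norm is finite.\<close>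

lemma epowr_ennreal: "0 \<le> x \<Longrightarrow> epowr (ennreal x) a = ennreal (x powr a)"
  by (simp add: epowr_def)

lemma epowr_0 [simp]: "epowr 0 a = 0"
  by (simp add: epowr_def)

lemma epowr_top [simp]: "epowr top a = top"
  by (simp add: epowr_def)

lemma epowr_mono: "0 \<le> a \<Longrightarrow> x \<le> y \<Longrightarrow> epowr x a \<le> epowr y a"
  by (cases x; cases y) (auto simp: epowr_ennreal ennreal_leI powr_mono2 top_unique)

lemma epowr_one [simp]: "epowr x 1 = x"
  by (cases x) (auto simp: epowr_ennreal)

lemma epowr_epowr: "epowr (epowr x a) b = epowr x (a * b)"
  by (cases x) (auto simp: epowr_ennreal powr_powr)

lemma epowr_eq_0_iff: "epowr x a = 0 \<longleftrightarrow> x = 0"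
  by (cases x) (auto simp: epowr_ennreal ennreal_eq_0_iff less_le)

lemma epowr_mult: "epowr (x * y) a = epowr x a * epowr y a"
proof (cases "x = top \<or> y = top")
  case True
  then show ?thesis
    by (cases "x = 0"; cases "y = 0") (auto simp: ennreal_top_mult ennreal_mult_top epowr_eq_0_iff)
next
  case False
  then show ?thesis
    by (cases x; cases y) (auto simp: epowr_ennreal powr_mult simp flip: ennreal_mult')
qed

lemma epowr_le_iff: "0 < a \<Longrightarrow> epowr x a \<le> epowr y a \<longleftrightarrow> x \<le> y"
  using epowr_mono[of a x y] epowr_mono[of "1/a" "epowr x a" "epowr y a"]
  by (auto simp: epowr_epowr)

text \<open>Bounding the sum by twice the maximum treats convex and concave powers alike; the sharp
  constant is irrelevant.\<close>

lemma epowr_add_le: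
  assumes "0 < a" shows "epowr (x + y) a \<le> ennreal (2 powr a) * (epowr x a + epowr y a)"
proof -
  have "epowr (x + y) a \<le> epowr (ennreal 2 * max x y) a"
    using assms by (intro epowr_mono) (auto simp: mult_2 add_mono)
  also have "\<dots> = ennreal (2 powr a) * max (epowr x a) (epowr y a)"
    using assms epowr_ennreal[of 2 a] unfolding epowr_mult by (simp add: max_def epowr_le_iff)
  also have "\<dots> \<le> ennreal (2 powr a) * (epowr x a + epowr y a)"
    by (intro mult_left_mono) auto
  finally show ?thesis .
qed

lemma epowr_measurable [measurable (raw)]:
  assumes [measurable]: "f \<in> borel_measurable M"
  shows "(\<lambda>x. epowr (f x) a) \<in> borel_measurable M"
  unfolding epowr_def infinity_ennreal_def by measurable

section \<open>Exponents and their reciprocals\<close>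

lemma expo_cases:
  assumes "0 < q"
  obtains "q = \<infinity>" "recip q = 0" | Q where "0 < Q" "q = ennreal Q" "recip q = 1 / Q"
proof (cases q)
  case (real r)
  then have "1 / q = ennreal (1 / r)"
    using assms by (metis divide_ennreal ennreal_1 ennreal_less_zero_iff zero_le_one)
  then show ?thesis using that real assms by simp
next
  case top
  then show ?thesis using that by simp
qed

lemma recip_pos: "0 < q \<Longrightarrow> q < \<infinity> \<Longrightarrow> 0 < recip q"
  by (erule expo_cases) auto

lemma recip_less_iff:
  assumes "0 < p" "p < \<infinity>" "0 < q"
  shows "recip q < recip p \<longleftrightarrow> p < q"
proof -
  obtain P where P: "0 < P" "p = ennreal P" "recip p = 1/P"
    using assms by (auto elim: expo_cases)
  show ?thesis using assms(3)
  proof (cases rule: expo_cases)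
    case 1
    then show ?thesis using P by (auto simp: less_top)
  next
    case (2 Q)
    then show ?thesis unfolding P(3) 2(3) using P(1) by (simp add: P(2) 2(2) ennreal_less_iff divide_simps)
  qed
qed

lemma interval_in_lebesgue: "{a<..<b::real} \<inter> space lebesgue \<in> sets lebesgue"
  by simp

lemma borel_lebesgue_on:
  "f \<in> borel_measurable borel \<Longrightarrow> f \<in> borel_measurable (lebesgue_on S)"
  by (intro measurable_restrict_space1 measurable_completion) simp

section \<open>Elementary rules for the norm on an interval\<close>

lemma Lnorm_infinity: "Lnorm \<infinity> a b g = esssup (lebesgue_on {a<..<b}) g"
  by (simp add: Lnorm_def)

text \<open>With the interval moved into an indicator, norms over different intervals become
  integrals against one measure.\<close>

lemma Lnorm_real:
  assumes "0 < Q"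
  shows "Lnorm (ennreal Q) a b g =
    epowr (\<integral>\<^sup>+ x. epowr (g x) Q * indicator {a<..<b} x \<partial>lebesgue) (1 / Q)"
proof -
  have "recip (ennreal Q) = 1 / Q"
    using assms by (metis divide_ennreal ennreal_1 enn2real_ennreal less_imp_le zero_le_divide_1_iff zero_le_one)
  then show ?thesis
    using assms by (simp add: Lnorm_def nn_integral_restrict_space)
qed

lemma AE_interval_iff:
  "(AE x in lebesgue_on {a<..<b::real}. P x) \<longleftrightarrow> (AE x in lebesgue. x \<in> {a<..<b} \<longrightarrow> P x)"
  by (rule AE_restrict_space_iff[OF interval_in_lebesgue])

text \<open>For \<open>q = \<infinity>\<close> a non-measurable function has \<open>esssup\<close>
  equal to \<open>top\<close>, so the smaller function must be measurable; the larger one may be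
  arbitrary.\<close>

lemma Lnorm_mono:
  assumes "0 < q" "g \<in> borel_measurable (lebesgue_on {a<..<b})"
    "\<And>x. a < x \<Longrightarrow> x < b \<Longrightarrow> g x \<le> h x"
  shows "Lnorm q a b g \<le> Lnorm q a b h"
  using assms(1)
proof (cases rule: expo_cases)
  case 1
  then show ?thesis unfolding 1 Lnorm_infinity
    using assms by (intro esssup_AE_mono) (auto intro!: AE_I2)
next
  case (2 Q)
  then show ?thesis unfolding 2 Lnorm_real[OF \<open>0 < Q\<close>] using assms
    by (intro epowr_mono nn_integral_mono) (auto simp: indicator_def intro!: epowr_mono)
qed

lemma Lnorm_cong:
  assumes "\<And>x. a < x \<Longrightarrow> x < b \<Longrightarrow> g x = h x"
  shows "Lnorm q a b g = Lnorm q a b h"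
proof -
  have "g \<in> borel_measurable (lebesgue_on {a<..<b}) \<longleftrightarrow> h \<in> borel_measurable (lebesgue_on {a<..<b})"
    using assms by (intro measurable_cong) auto
  moreover have "Limsup (ae_filter (lebesgue_on {a<..<b})) g = Limsup (ae_filter (lebesgue_on {a<..<b})) h"
    using assms by (intro Limsup_eq AE_I2) auto
  ultimately have "esssup (lebesgue_on {a<..<b}) g = esssup (lebesgue_on {a<..<b}) h"
    by (simp add: esssup_def)
  moreover have "(\<integral>\<^sup>+ x. epowr (g x) r \<partial>lebesgue_on {a<..<b}) = (\<integral>\<^sup>+ x. epowr (h x) r \<partial>lebesgue_on {a<..<b})" for r
    using assms by (intro nn_integral_cong) auto
  ultimately show ?thesis by (simp add: Lnorm_def)
qed

lemma esssup_cmult_ennreal_le: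
  fixes g :: "'a \<Rightarrow> ennreal"
  assumes "g \<in> borel_measurable M"
  shows "esssup M (\<lambda>x. c * g x) \<le> c * esssup M g"
  using assms esssup_AE[where M=M and f=g]
  by (intro esssup_I) (auto elim!: eventually_mono intro: mult_left_mono)

lemma esssup_cmult_ennreal:
  fixes g :: "'a \<Rightarrow> ennreal"
  assumes g [measurable]: "g \<in> borel_measurable M"
  shows "esssup M (\<lambda>x. c * g x) = c * esssup M g"
proof (rule antisym[OF esssup_cmult_ennreal_le[OF g]])
  consider "c = 0" | r where "c = ennreal r" "0 < r" | "c = top"
    by (cases c) (auto simp: less_le ennreal_eq_0_iff)
  then show "c * esssup M g \<le> esssup M (\<lambda>x. c * g x)"
  proof cases
    case 2
    have *: "ennreal (1 / r) * (c * x) = x" "c * (ennreal (1 / r) * x) = x" for x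
      using 2 by (simp_all flip: mult.assoc ennreal_mult')
    have "esssup M g \<le> ennreal (1 / r) * esssup M (\<lambda>x. c * g x)"
      using esssup_cmult_ennreal_le[of "\<lambda>x. c * g x" M "ennreal (1 / r)"] unfolding * by simp
    from mult_left_mono[OF this, of c] show ?thesis
      unfolding * by simp
  next
    case 3
    show ?thesis
    proof (rule ccontr)
      \<comment> \<open>The right-hand side is then below \<open>top\<close>, so \<open>g\<close>
        vanishes almost everywhere, and the convention \<open>top * 0 = 0\<close> contradicts the
        assumption.\<close>
      assume less: "\<not> c * esssup M g \<le> esssup M (\<lambda>x. c * g x)"
      have "AE x in M. g x \<le> 0"
        using esssup_AE[where M=M and f="\<lambda>x. c * g x"]
      proof eventually_elim
        case (elim x)
        then have "c * g x < top"
          using less by (auto simp: not_le intro: le_less_trans less_le_trans)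
        then show ?case using 3 by (auto simp: ennreal_top_mult split: if_splits)
      qed
      then have "esssup M g \<le> 0" by (intro esssup_I) auto
      then show False using less by simp
    qed
  qed simp
qed

lemma Lnorm_cmult:
  assumes "0 < q" "g \<in> borel_measurable (lebesgue_on {a<..<b})"
  shows "Lnorm q a b (\<lambda>x. c * g x) = c * Lnorm q a b g"
  using assms(1)
proof (cases rule: expo_cases)
  case 1
  then show ?thesis unfolding 1 Lnorm_infinity by (intro esssup_cmult_ennreal assms)
next
  case (2 Q)
  have "(\<integral>\<^sup>+ x. epowr (c * g x) Q * indicator {a<..<b} x \<partial>lebesgue)
      = epowr c Q * (\<integral>\<^sup>+ x. epowr (g x) Q * indicator {a<..<b} x \<partial>lebesgue)"
    unfolding epowr_mult mult.assoc using assms(2)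
    by (intro nn_integral_cmult)
      (auto simp flip: borel_measurable_restrict_space_iff_ennreal[OF interval_in_lebesgue])
  then show ?thesis using 2 unfolding 2 Lnorm_real[OF \<open>0 < Q\<close>]
    by (simp add: epowr_mult epowr_epowr)
qed

text \<open>True for arbitrary \<open>g\<close>: if \<open>g\<close> is not measurable on the larger
  interval, the supremum norm there is \<open>top\<close>.\<close>

lemma Lnorm_subinterval:
  assumes "0 < q" "a' \<le> a" "b \<le> b'"
  shows "Lnorm q a b g \<le> Lnorm q a' b' g"
  using assms(1)
proof (cases rule: expo_cases)
  case 1
  show ?thesis
  proof (cases "g \<in> borel_measurable (lebesgue_on {a'<..<b'})")
    case True
    moreover have "{a<..<b} \<subseteq> {a'<..<b'}" using assms by auto
    ultimately have "g \<in> borel_measurable (lebesgue_on {a<..<b})"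
      using measurable_restrict_mono by blast
    moreover have "AE x in lebesgue_on {a<..<b}. g x \<le> esssup (lebesgue_on {a'<..<b'}) g"
      using esssup_AE[where M="lebesgue_on {a'<..<b'}" and f=g] assms
      unfolding AE_interval_iff by (auto elim!: eventually_mono)
    ultimately show ?thesis unfolding 1 Lnorm_infinity by (rule esssup_I)
  qed (simp only: 1 Lnorm_infinity esssup_non_measurable top_greatest not_False_eq_True)
next
  case (2 Q)
  then show ?thesis unfolding 2 Lnorm_real[OF \<open>0 < Q\<close>] using assms
    by (intro epowr_mono nn_integral_mono) (auto simp: indicator_def)
qed

text \<open>The triangle inequality fails for exponents below 1. The constant is obtained before
  interval and functions are fixed and is therefore uniform in them; the later estimates have the
  same form for the same reason.\<close>

lemma Lnorm_add_le:
  assumes "0 < q"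
  obtains C :: real where "0 < C"
    "\<And>a b f g. f \<in> borel_measurable (lebesgue_on {a<..<b}) \<Longrightarrow> g \<in> borel_measurable (lebesgue_on {a<..<b})
      \<Longrightarrow> Lnorm q a b (\<lambda>x. f x + g x) \<le> ennreal C * (Lnorm q a b f + Lnorm q a b g)"
  using assms
proof (cases rule: expo_cases)
  case 1
  show ?thesis
  proof (rule that[of 1])
    fix a b :: real and f g :: "real \<Rightarrow> ennreal"
    let ?M = "lebesgue_on {a<..<b}"
    assume "f \<in> borel_measurable ?M" "g \<in> borel_measurable ?M"
    moreover have "AE x in ?M. f x + g x \<le> esssup ?M f + esssup ?M g"
      using esssup_AE[where M="?M" and f=g] esssup_AE[where M="?M" and f=f]
      by eventually_elim (rule add_mono)
    ultimately have "esssup ?M (\<lambda>x. f x + g x) \<le> esssup ?M f + esssup ?M g"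
      by (intro esssup_I) auto
    then show "Lnorm q a b (\<lambda>x. f x + g x) \<le> ennreal 1 * (Lnorm q a b f + Lnorm q a b g)"
      unfolding 1 Lnorm_infinity by simp
  qed simp
next
  case (2 Q)
  show ?thesis
  proof (rule that[of "2 * 2 powr (1/Q)"])
    fix a b :: real and f g :: "real \<Rightarrow> ennreal"
    assume m [measurable]: "f \<in> borel_measurable (lebesgue_on {a<..<b})" "g \<in> borel_measurable (lebesgue_on {a<..<b})"
    let ?M = "lebesgue_on {a<..<b}"
    define F where "F = (\<integral>\<^sup>+ x. epowr (f x) Q \<partial>?M)"
    define G where "G = (\<integral>\<^sup>+ x. epowr (g x) Q \<partial>?M)"
    have L: "Lnorm q a b h = epowr (\<integral>\<^sup>+ x. epowr (h x) Q \<partial>?M) (1/Q)" for h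
      using 2 unfolding Lnorm_def by simp
    have "(\<integral>\<^sup>+ x. epowr (f x + g x) Q \<partial>?M) \<le> (\<integral>\<^sup>+ x. ennreal (2 powr Q) * (epowr (f x) Q + epowr (g x) Q) \<partial>?M)"
      by (intro nn_integral_mono epowr_add_le \<open>0 < Q\<close>)
    also have "\<dots> = ennreal (2 powr Q) * (F + G)"
      unfolding F_def G_def by (simp add: nn_integral_cmult nn_integral_add)
    finally have "Lnorm q a b (\<lambda>x. f x + g x) \<le> epowr (ennreal (2 powr Q) * (F + G)) (1/Q)"
      unfolding L using \<open>0 < Q\<close> by (intro epowr_mono) auto
    also have "\<dots> = ennreal 2 * epowr (F + G) (1/Q)"
      using \<open>0 < Q\<close> by (simp add: epowr_mult epowr_ennreal powr_powr)
    also have "\<dots> \<le> ennreal 2 * (ennreal (2 powr (1/Q)) * (epowr F (1/Q) + epowr G (1/Q)))"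
      using \<open>0 < Q\<close> by (intro mult_left_mono epowr_add_le) auto
    finally show "Lnorm q a b (\<lambda>x. f x + g x) \<le> ennreal (2 * 2 powr (1/Q)) * (Lnorm q a b f + Lnorm q a b g)"
      unfolding L F_def G_def by (simp add: ennreal_mult' mult.assoc)
  qed simp
qed

lemma Lnorm_split_le:
  assumes "0 < q"
  obtains C :: real where "0 < C"
    "\<And>a b c g. g \<in> borel_measurable (lebesgue_on {a<..<b})
      \<Longrightarrow> Lnorm q a b g \<le> ennreal C * (Lnorm q a c g + Lnorm q c b g)"
  using assms
proof (cases rule: expo_cases)
  case 1
  show ?thesis
  proof (rule that[of 1])
    fix a b c :: real and g :: "real \<Rightarrow> ennreal"
    assume "g \<in> borel_measurable (lebesgue_on {a<..<b})"
    \<comment> \<open>The point \<open>c\<close> belongs to neither piece. The three points may come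
      in any order: if \<open>c\<close> lies outside the interval, one of the two pieces contains
      all of it.\<close>
    moreover have "AE x in lebesgue. x \<noteq> c" by (intro AE_completion AE_lborel_singleton)
    then have "AE x in lebesgue_on {a<..<b}. g x \<le>
        esssup (lebesgue_on {a<..<c}) g + esssup (lebesgue_on {c<..<b}) g"
      using esssup_AE[where M="lebesgue_on {a<..<c}" and f=g] esssup_AE[where M="lebesgue_on {c<..<b}" and f=g]
      unfolding AE_interval_iff
    proof eventually_elim
      case (elim x)
      then show ?case
        by (cases x c rule: linorder_cases) (auto intro: add_increasing add_increasing2)
    qed
    ultimately show "Lnorm q a b g \<le> ennreal 1 * (Lnorm q a c g + Lnorm q c b g)"
      unfolding 1 Lnorm_infinity by (simp add: esssup_I)
  qed simp
next
  case (2 Q)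
  show ?thesis
  proof (rule that[of "2 powr (1/Q)"])
    fix a b c :: real and g :: "real \<Rightarrow> ennreal"
    assume g: "g \<in> borel_measurable (lebesgue_on {a<..<b})"
    let ?I = "\<lambda>a b. \<integral>\<^sup>+ x. epowr (g x) Q * indicator {a<..<b} x \<partial>lebesgue"
    have "(\<lambda>x. epowr (g x) Q) \<in> borel_measurable (lebesgue_on {a<..<b})"
      using g by auto
    then have g': "(\<lambda>x. epowr (g x) Q * indicator {a<..<b} x) \<in> borel_measurable lebesgue"
      by (simp only: borel_measurable_restrict_space_iff_ennreal[OF interval_in_lebesgue])
    have "AE x in lebesgue. x \<noteq> c" by (intro AE_completion AE_lborel_singleton)
    then have "?I a b \<le> (\<integral>\<^sup>+ x. (epowr (g x) Q * indicator {a<..<b} x) * indicator {..<c} x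
        + (epowr (g x) Q * indicator {a<..<b} x) * indicator {c<..} x \<partial>lebesgue)"
      by (intro nn_integral_mono_AE) (auto elim!: eventually_mono simp: indicator_def)
    also have "\<dots> = (\<integral>\<^sup>+ x. (epowr (g x) Q * indicator {a<..<b} x) * indicator {..<c} x \<partial>lebesgue)
        + (\<integral>\<^sup>+ x. (epowr (g x) Q * indicator {a<..<b} x) * indicator {c<..} x \<partial>lebesgue)"
      by (intro nn_integral_add borel_measurable_times_ennreal g' borel_measurable_indicator) auto
    also have "\<dots> \<le> ?I a c + ?I c b"
      by (intro add_mono nn_integral_mono) (auto simp: indicator_def)
    finally have "epowr (?I a b) (1/Q) \<le> epowr (?I a c + ?I c b) (1/Q)"
      using \<open>0 < Q\<close> by (intro epowr_mono) auto
    also have "\<dots> \<le> ennreal (2 powr (1/Q)) * (epowr (?I a c) (1/Q) + epowr (?I c b) (1/Q))"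
      using \<open>0 < Q\<close> by (intro epowr_add_le) auto
    finally show "Lnorm q a b g \<le> ennreal (2 powr (1/Q)) * (Lnorm q a c g + Lnorm q c b g)"
      unfolding 2 Lnorm_real[OF \<open>0 < Q\<close>] .
  qed simp
qed

lemma Lnorm_const:
  assumes "0 < q" "a < b" "0 \<le> k"
  shows "Lnorm q a b (\<lambda>_. ennreal k) = ennreal (k * (b - a) powr recip q)"
  using assms(1)
proof (cases rule: expo_cases)
  case 1
  have "esssup (lebesgue_on {a<..<b}) (\<lambda>_. ennreal k) = ennreal k"
    using \<open>a < b\<close> by (intro esssup_const) (simp add: emeasure_restrict_space space_restrict_space)
  then show ?thesis using 1 \<open>a < b\<close> unfolding 1 Lnorm_infinity by simp
next
  case (2 Q)
  then show ?thesis unfolding 2 Lnorm_real[OF \<open>0 < Q\<close>] using assms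
    by (simp add: epowr_ennreal nn_integral_cmult_indicator powr_mult powr_powr flip: ennreal_mult')
qed

section \<open>Norms of power functions\<close>

lemma powr_Lnorm_measurable:
  "(\<lambda>w. ennreal (w powr a)) \<in> borel_measurable (lebesgue_on S)"
  by (intro borel_lebesgue_on) measurable

text \<open>The minimum covers both signs of \<open>d\<close>: the worst point of the block is its
  left end for \<open>0 \<le> d\<close> and its right end for \<open>d < 0\<close>.\<close>

lemma powr_ge_dyadic:
  fixes v w d :: real
  assumes "0 < v" "v / 2 \<le> w" "w \<le> v"
  shows "min 1 ((1/2) powr d) * v powr d \<le> w powr d"
proof (cases "0 \<le> d")
  case True
  have "min 1 ((1/2) powr d) * v powr d \<le> (1/2) powr d * v powr d"
    by (intro mult_right_mono) auto
  also have "\<dots> = (v / 2) powr d"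
    using assms by (simp flip: powr_mult)
  also have "\<dots> \<le> w powr d"
    using assms True by (intro powr_mono2) auto
  finally show ?thesis .
next
  case False
  have "min 1 ((1/2) powr d) * v powr d \<le> 1 * v powr d"
    by (intro mult_right_mono) auto
  also have "\<dots> \<le> w powr d"
    using assms False powr_mono2'[of d w v] by simp
  finally show ?thesis .
qed

text \<open>The weight is comparable to \<open>v powr (a - recip q)\<close> on the block, whose
  length contributes \<open>v powr recip q\<close>. Away from the origin this works for every real
  \<open>a\<close>, whatever its sign.\<close>

lemma Lnorm_powr_dyadic:
  assumes "0 < q"
  obtains c :: real where "0 < c"
    "\<And>v. 0 < v \<Longrightarrow> ennreal (c * v powr a) \<le> Lnorm q (v / 2) v (\<lambda>w. ennreal (w powr (a - recip q)))"
proof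
  let ?d = "a - recip q"
  let ?c = "min 1 ((1/2) powr ?d)"
  show "0 < ?c * (1/2) powr recip q" by simp
  fix v :: real assume v: "0 < v"
  have "v powr a = v powr ?d * v powr recip q"
    using v by (simp flip: powr_add)
  then have "ennreal (?c * (1/2) powr recip q * v powr a) = ennreal (?c * v powr ?d * (v - v/2) powr recip q)"
    using v by (simp add: powr_divide mult_ac)
  also have "\<dots> = Lnorm q (v / 2) v (\<lambda>w. ennreal (?c * v powr ?d))"
    using v by (subst Lnorm_const[OF assms]) auto
  also have "\<dots> \<le> Lnorm q (v / 2) v (\<lambda>w. ennreal (w powr ?d))"
    using v by (intro Lnorm_mono assms ennreal_leI powr_ge_dyadic) auto
  finally show "ennreal (?c * (1/2) powr recip q * v powr a) \<le> Lnorm q (v / 2) v (\<lambda>w. ennreal (w powr ?d))" .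
qed

lemma nn_integral_powr_lower:
  assumes "0 < a" "0 < u"
  shows "(\<integral>\<^sup>+ x. ennreal (x powr (a - 1)) * indicator {0<..<u} x \<partial>lebesgue) = ennreal (u powr a / a)"
proof -
  have "((\<lambda>x. x powr (a - 1)) has_integral (u powr (a - 1 + 1) / (a - 1 + 1))) {0..u}"
    using assms by (intro has_integral_powr_from_0) auto
  then have "((\<lambda>x. x powr (a - 1)) has_integral (u powr a / a)) {0<..<u}"
    by (subst (asm) has_integral_Icc_iff_Ioo) simp
  then have "(\<integral>\<^sup>+ x. ennreal (indicator {0<..<u} x * x powr (a - 1)) \<partial>lborel) = ennreal (u powr a / a)"
    by (intro nn_integral_has_integral_lebesgue) auto
  then show ?thesis unfolding nn_integral_completion
    by (simp add: ennreal_mult' ennreal_indicator mult.commute)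
qed

text \<open>Integrating up to infinity gives a bound that is uniform in \<open>T\<close>.\<close>

lemma nn_integral_powr_upper:
  assumes "0 < a" "0 < u"
  shows "(\<integral>\<^sup>+ x. ennreal (x powr (- a - 1)) * indicator {u<..<T} x \<partial>lebesgue) \<le> ennreal (u powr (- a) / a)"
proof -
  have "((\<lambda>x. x powr (- a - 1)) has_integral (- (u powr (- a - 1 + 1)) / (- a - 1 + 1))) {u..}"
    using assms by (intro has_integral_powr_to_inf) auto
  then have "(\<integral>\<^sup>+ x. ennreal (indicator {u..} x * x powr (- a - 1)) \<partial>lborel)
      = ennreal (u powr (- a) / a)"
    by (intro nn_integral_has_integral_lebesgue) auto
  then have *: "(\<integral>\<^sup>+ x. ennreal (x powr (- a - 1)) * indicator {u..} x \<partial>lborel) = ennreal (u powr (- a) / a)"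
    by (simp add: ennreal_mult' ennreal_indicator mult.commute)
  show ?thesis unfolding nn_integral_completion *[symmetric]
    by (intro nn_integral_mono) (auto simp: indicator_def)
qed

lemma powr_root_divide:
  fixes u a Q :: real
  assumes "0 < Q" "0 < a"
  shows "(u powr (b * Q) / (a * Q)) powr (1 / Q) = (a * Q) powr (- 1 / Q) * u powr b"
proof -
  have "(u powr (b * Q) / (a * Q)) powr (1 / Q) = u powr b / (a * Q) powr (1 / Q)"
    using assms by (subst powr_divide) (auto simp: powr_powr)
  also have "\<dots> = (a * Q) powr (- 1 / Q) * u powr b"
    using powr_minus_divide[of "a * Q" "1 / Q"] by simp
  finally show ?thesis .
qed

text \<open>An equation and not merely a bound, because its constant reappears as the eigenvalue in
  the counterexample, where its growth as \<open>a\<close> tends to 0 is decisive.\<close>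

lemma Lnorm_powr_lower_real:
  assumes "0 < Q" "0 < a" "0 < u"
  shows "Lnorm (ennreal Q) 0 u (\<lambda>w. ennreal (w powr (a - 1 / Q))) =
    ennreal ((a * Q) powr (- 1 / Q) * u powr a)"
proof -
  have "(a - 1 / Q) * Q = a * Q - 1"
    using assms by (simp add: field_simps)
  then have "Lnorm (ennreal Q) 0 u (\<lambda>w. ennreal (w powr (a - 1 / Q))) =
      epowr (\<integral>\<^sup>+ x. ennreal (x powr (a * Q - 1)) * indicator {0<..<u} x \<partial>lebesgue) (1 / Q)"
    using assms by (simp add: Lnorm_real epowr_ennreal powr_powr)
  also have "\<dots> = ennreal ((u powr (a * Q) / (a * Q)) powr (1 / Q))"
    using assms by (subst nn_integral_powr_lower) (auto simp: epowr_ennreal)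
  also have "(u powr (a * Q) / (a * Q)) powr (1 / Q) = (a * Q) powr (- 1 / Q) * u powr a"
    using assms by (intro powr_root_divide)
  finally show ?thesis .
qed

lemma Lnorm_powr_lower:
  assumes "0 < q" "0 < a"
  obtains C :: real where "0 < C"
    "\<And>u. 0 < u \<Longrightarrow> Lnorm q 0 u (\<lambda>w. ennreal (w powr (a - recip q))) \<le> ennreal (C * u powr a)"
  using assms(1)
proof (cases rule: expo_cases)
  case 1
  show ?thesis
  proof (rule that[of 1])
    fix u :: real assume "0 < u"
    have "AE x in lebesgue_on {0<..<u}. ennreal (x powr (a - recip q)) \<le> ennreal (u powr a)"
      using \<open>0 < a\<close> unfolding 1 by (intro AE_I2 ennreal_leI) (auto intro: powr_mono2)
    then show "Lnorm q 0 u (\<lambda>w. ennreal (w powr (a - recip q))) \<le> ennreal (1 * u powr a)"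
      using powr_Lnorm_measurable unfolding 1 Lnorm_infinity by (intro esssup_I) auto
  qed simp
next
  case (2 Q)
  show ?thesis
    by (rule that[of "(a * Q) powr (- 1 / Q)"])
      (unfold 2(3), unfold 2(2), use 2(1) \<open>0 < a\<close> in \<open>auto simp: Lnorm_powr_lower_real\<close>)
qed

lemma Lnorm_powr_upper:
  assumes "0 < q" "0 < a"
  obtains C :: real where "0 < C"
    "\<And>u T. 0 < u \<Longrightarrow> Lnorm q u T (\<lambda>w. ennreal (w powr (- a - recip q))) \<le> ennreal (C * u powr (- a))"
  using assms(1)
proof (cases rule: expo_cases)
  case 1
  show ?thesis
  proof (rule that[of 1])
    fix u T :: real assume "0 < u"
    then have "AE x in lebesgue_on {u<..<T}. ennreal (x powr (- a - recip q)) \<le> ennreal (u powr (- a))"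
      using \<open>0 < a\<close> unfolding 1 by (intro AE_I2 ennreal_leI) (auto intro: powr_mono2')
    then show "Lnorm q u T (\<lambda>w. ennreal (w powr (- a - recip q))) \<le> ennreal (1 * u powr (- a))"
      using powr_Lnorm_measurable unfolding 1 Lnorm_infinity by (intro esssup_I) auto
  qed simp
next
  case (2 Q)
  show ?thesis
  proof (rule that[of "(a * Q) powr (- 1 / Q)"])
    fix u T :: real assume "0 < u"
    have "(- a - 1 / Q) * Q = - (a * Q) - 1"
      using 2 by (simp add: field_simps)
    then have "Lnorm (ennreal Q) u T (\<lambda>w. ennreal (w powr (- a - 1 / Q))) =
        epowr (\<integral>\<^sup>+ x. ennreal (x powr (- (a * Q) - 1)) * indicator {u<..<T} x \<partial>lebesgue) (1 / Q)"
      using 2 by (simp add: Lnorm_real epowr_ennreal powr_powr)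
    also have "\<dots> \<le> epowr (ennreal (u powr (- (a * Q)) / (a * Q))) (1 / Q)"
      using 2 assms \<open>0 < u\<close> by (intro epowr_mono nn_integral_powr_upper) auto
    also have "\<dots> = ennreal ((a * Q) powr (- 1 / Q) * u powr (- a))"
      using 2 assms powr_root_divide[of Q a u "- a"] by (simp add: epowr_ennreal)
    finally show "Lnorm q u T (\<lambda>w. ennreal (w powr (- a - recip q))) \<le>
        ennreal ((a * Q) powr (- 1 / Q) * u powr (- a))"
      unfolding 2(3) unfolding 2(2) .
  qed (use 2 assms in auto)
qed

section \<open>Dilations\<close>

lemma Lnorm_scale_le:
  assumes "0 < q" "0 < s" "g \<in> borel_measurable borel"
  shows "Lnorm q 0 (s * t) g \<le> ennreal (s powr recip q) * Lnorm q 0 t (\<lambda>y. g (s * y))"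
  using assms(1)
proof (cases rule: expo_cases)
  case 1
  let ?E = "esssup (lebesgue_on {0<..<t}) (\<lambda>y. g (s * y))"
  have "AE y in lebesgue. y \<in> {0<..<t} \<longrightarrow> g (s * y) \<le> ?E"
    using esssup_AE[where M="lebesgue_on {0<..<t}" and f="\<lambda>y. g (s * y)"] unfolding AE_interval_iff .
  \<comment> \<open>A null set of the completion lies in a Borel null set, so the statement passes
    to \<open>lborel\<close>, where the affine substitution is carried out; there the Borel
    measurability of \<open>g\<close> enters.\<close>
  then have "AE y in lborel. y \<in> {0<..<t} \<longrightarrow> g (s * y) \<le> ?E"
    by (simp add: AE_completion_iff)
  then have "AE y in lborel. (0 + (1/s) * y) \<in> {0<..<t} \<longrightarrow> g (s * (0 + (1/s) * y)) \<le> ?E"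
    using assms by (intro AE_borel_affine) auto
  then have "AE y in lborel. y \<in> {0<..<s * t} \<longrightarrow> g y \<le> ?E"
    using \<open>0 < s\<close> by (auto elim!: eventually_mono simp: field_simps)
  then have "AE y in lebesgue_on {0<..<s * t}. g y \<le> ?E"
    unfolding AE_interval_iff by (rule AE_completion)
  then show ?thesis
    using \<open>0 < s\<close> unfolding 1 Lnorm_infinity by (auto intro!: esssup_I borel_lebesgue_on assms)
next
  case (2 Q)
  have [measurable]: "g \<in> borel_measurable borel" by fact
  have ind: "indicator {0<..<s * t} (s * y) = (indicator {0<..<t} y :: ennreal)" for y
    using \<open>0 < s\<close> by (auto simp: indicator_def zero_less_mult_iff)
  have "(\<integral>\<^sup>+ x. epowr (g x) Q * indicator {0<..<s * t} x \<partial>lborel) =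
      ennreal s * (\<integral>\<^sup>+ y. epowr (g (s * y)) Q * indicator {0<..<t} y \<partial>lborel)"
    using \<open>0 < s\<close> by (subst nn_integral_real_affine[where c=s and t=0]) (auto simp: ind)
  then show ?thesis
    using assms unfolding 2(3) unfolding 2(2) Lnorm_real[OF \<open>0 < Q\<close>] nn_integral_completion
    by (simp add: epowr_mult epowr_ennreal)
qed

text \<open>The weight yields \<open>s powr (a - recip q)\<close> and the substitution yields
  \<open>s powr recip q\<close>. The shift by \<open>recip q\<close> in the weights thus makes the
  norm homogeneous of degree \<open>a\<close>, whatever \<open>q\<close> is.\<close>

lemma Lnorm_scale_powr_le:
  assumes "0 < q" "0 < s" "h \<in> borel_measurable borel"
  shows "Lnorm q 0 (s * t) (\<lambda>w. ennreal (w powr (a - recip q)) * h w) \<le>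
    ennreal (s powr a) * Lnorm q 0 t (\<lambda>w. ennreal (w powr (a - recip q)) * h (s * w))"
proof -
  have [measurable]: "h \<in> borel_measurable borel" by fact
  have "Lnorm q 0 (s * t) (\<lambda>w. ennreal (w powr (a - recip q)) * h w) \<le>
      ennreal (s powr recip q) * Lnorm q 0 t (\<lambda>w. ennreal ((s * w) powr (a - recip q)) * h (s * w))"
    by (intro Lnorm_scale_le assms) measurable
  also have "Lnorm q 0 t (\<lambda>w. ennreal ((s * w) powr (a - recip q)) * h (s * w)) =
      Lnorm q 0 t (\<lambda>w. ennreal (s powr (a - recip q)) * (ennreal (w powr (a - recip q)) * h (s * w)))"
    using \<open>0 < s\<close> by (intro Lnorm_cong) (simp add: powr_mult ennreal_mult' mult.assoc)
  also have "\<dots> = ennreal (s powr (a - recip q)) * Lnorm q 0 t (\<lambda>w. ennreal (w powr (a - recip q)) * h (s * w))"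
    using \<open>0 < s\<close> by (intro Lnorm_cmult assms borel_lebesgue_on) auto
  finally show ?thesis
    using \<open>0 < s\<close> by (simp flip: mult.assoc ennreal_mult' powr_add)
qed

section \<open>Hardy-type inequalities\<close>

text \<open>
  For \<open>q = \<infinity>\<close> the kernel is bounded pointwise rather than in norm, because \<open>R\<close>-sections of null
  sets would otherwise have to be discussed.
\<close>

lemma hardy_kernel:
  fixes R :: "(real \<times> real) set" and \<kappa> :: "real \<Rightarrow> real \<Rightarrow> ennreal" and A :: "real \<Rightarrow> real"
  assumes q: "0 < q"
    and A: "A \<in> borel_measurable (lebesgue_on {0<..<T})"
    and B: "B \<in> borel_measurable (lebesgue_on {0<..<T})"
    and g: "g \<in> borel_measurable (lebesgue_on {0<..<T})"
    and R: "R \<in> sets borel"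
    and \<kappa>: "\<And>w. (\<lambda>x. \<kappa> x w * indicator R (x, w)) \<in> borel_measurable (lebesgue_on {0<..<T})"
    and N: "N \<in> borel_measurable (lebesgue_on {0<..<T})"
    and N_le: "\<And>x. x \<in> {0<..<T} \<Longrightarrow> N x \<le> Lnorm q 0 T (\<lambda>w. g w * indicator R (x, w))"
    and le: "\<And>x w. x \<in> {0<..<T} \<Longrightarrow> w \<in> {0<..<T} \<Longrightarrow> (x, w) \<in> R \<Longrightarrow> ennreal (A x) \<le> \<kappa> x w * B w"
    and bound: "\<And>x w. q = \<infinity> \<Longrightarrow> x \<in> {0<..<T} \<Longrightarrow> w \<in> {0<..<T} \<Longrightarrow> (x, w) \<in> R \<Longrightarrow> \<kappa> x w \<le> K"
    and norm: "\<And>w. q \<noteq> \<infinity> \<Longrightarrow> w \<in> {0<..<T} \<Longrightarrow>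
      Lnorm q 0 T (\<lambda>x. \<kappa> x w * indicator R (x, w)) \<le> K"
  shows "Lnorm q 0 T (\<lambda>x. ennreal (A x) * N x)
      \<le> K * Lnorm q 0 T (\<lambda>w. B w * g w)"
proof -
  let ?M = "lebesgue_on {0<..<T}"
  interpret M: finite_measure ?M
    by (intro finite_measure_lebesgue_on) simp
  interpret MM: pair_sigma_finite ?M ?M ..
  have id: "(\<lambda>x. x) \<in> measurable ?M borel"
    by (intro measurable_restrict_space1 measurable_completion) simp
  \<comment> \<open>The product of two restricted Lebesgue spaces is not complete. So
    \<open>R\<close> is Borel and is pulled back along the identity, which is measurable into
    \<open>borel\<close>.\<close>
  have "(\<lambda>z. (fst z, snd z)) \<in> measurable (?M \<Otimes>\<^sub>M ?M) borel"
    by (rule borel_measurable_Pair[OF measurable_compose[OF measurable_fst id] measurable_compose[OF measurable_snd id]])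
  then have ind [measurable]: "(\<lambda>z. indicator R (fst z, snd z) :: ennreal) \<in> borel_measurable (?M \<Otimes>\<^sub>M ?M)"
    by (rule measurable_compose) (use R in auto)
  have ind2 [measurable]: "(\<lambda>x. indicator R (x, w) :: ennreal) \<in> borel_measurable ?M" if "w \<in> {0<..<T}" for w
    using measurable_Pair1[OF ind, of w] that by (simp add: space_restrict_space)
  have ind1 [measurable]: "(\<lambda>w. indicator R (x, w) :: ennreal) \<in> borel_measurable ?M" if "x \<in> {0<..<T}" for x
    using measurable_Pair2[OF ind, of x] that by (simp add: space_restrict_space)
  note [measurable] = A B g
  show ?thesis using q
  proof (cases rule: expo_cases)
    case 1
    have pt: "ennreal (A x) * N x \<le> K * Lnorm q 0 T (\<lambda>w. B w * g w)"
      if x: "x \<in> {0<..<T}" for x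
    proof -
      have "ennreal (A x) * N x \<le> ennreal (A x) * Lnorm q 0 T (\<lambda>w. g w * indicator R (x, w))"
        using x by (intro mult_left_mono N_le) auto
      also have "\<dots> = Lnorm q 0 T (\<lambda>w. ennreal (A x) * (g w * indicator R (x, w)))"
        using x q by (intro Lnorm_cmult[symmetric]) auto
      also have "\<dots> \<le> Lnorm q 0 T (\<lambda>w. K * (B w * g w))"
      proof (intro Lnorm_mono q)
        show "(\<lambda>w. ennreal (A x) * (g w * indicator R (x, w))) \<in> borel_measurable ?M"
          using x by measurable
        fix w assume w: "0 < w" "w < T"
        show "ennreal (A x) * (g w * indicator R (x, w)) \<le> K * (B w * g w)"
        proof (cases "(x, w) \<in> R")
          case True
          have "ennreal (A x) \<le> \<kappa> x w * B w"
            using True w x by (intro le) auto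
          also have "\<dots> \<le> K * B w"
            using True w x 1 by (intro mult_right_mono bound) auto
          finally show ?thesis using True
            by (simp add: mult_right_mono flip: mult.assoc)
        qed simp
      qed
      also have "\<dots> = K * Lnorm q 0 T (\<lambda>w. B w * g w)"
        by (intro Lnorm_cmult q) measurable
      finally show ?thesis .
    qed
    have "(\<lambda>x. ennreal (A x) * N x) \<in> borel_measurable ?M"
      using N by measurable
    then show ?thesis
      using pt unfolding 1 Lnorm_infinity by (intro esssup_I AE_I2) auto
  next
    case (2 Q)
    have L: "Lnorm q 0 T h = epowr (\<integral>\<^sup>+ x. epowr (h x) Q \<partial>?M) (1/Q)" for h
      using 2 unfolding Lnorm_def by simp
    have Q: "0 < Q" by fact
    have L': "(\<integral>\<^sup>+ x. epowr (h x) Q \<partial>?M) = epowr (Lnorm q 0 T h) Q" for h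
      unfolding L using Q by (simp add: epowr_epowr)
    have epi: "epowr (indicator R z) Q = indicator R z" for z
      using Q by (simp add: indicator_def epowr_ennreal flip: ennreal_1)
    \<comment> \<open>As the two exponents agree, the \<open>Q\<close>-th power of the left-hand
      norm is at most the double integral of \<open>F\<close>. Exchanging the integrals leaves, for
      fixed \<open>w\<close>, a norm of the kernel in \<open>x\<close>, which is at most
      \<open>K\<close>.\<close>
    define F where "F x w = epowr (ennreal (A x)) Q * epowr (g w) Q * indicator R (x, w)" for x w
    have F [measurable]: "case_prod F \<in> borel_measurable (?M \<Otimes>\<^sub>M ?M)"
    proof -
      have "(\<lambda>z. epowr (ennreal (A (fst z))) Q * epowr (g (snd z)) Q * indicator R (fst z, snd z))
          \<in> borel_measurable (?M \<Otimes>\<^sub>M ?M)"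
        by measurable
      then show ?thesis unfolding F_def by (simp add: case_prod_beta)
    qed
    have "(\<integral>\<^sup>+ x. epowr (ennreal (A x) * N x) Q \<partial>?M)
        \<le> (\<integral>\<^sup>+ x. epowr (ennreal (A x)) Q * epowr (Lnorm q 0 T (\<lambda>w. g w * indicator R (x, w))) Q \<partial>?M)"
      unfolding epowr_mult using Q N_le
      by (intro nn_integral_mono mult_left_mono epowr_mono) (auto simp: space_restrict_space)
    also have "\<dots> = (\<integral>\<^sup>+ x. epowr (ennreal (A x)) Q * (\<integral>\<^sup>+ w. epowr (g w * indicator R (x, w)) Q \<partial>?M) \<partial>?M)"
      by (simp only: L')
    also have "\<dots> = (\<integral>\<^sup>+ x. (\<integral>\<^sup>+ w. F x w \<partial>?M) \<partial>?M)"
      unfolding F_def epowr_mult epi mult.assoc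
      by (intro nn_integral_cong nn_integral_cmult[symmetric]) (auto simp: space_restrict_space)
    also have "\<dots> = (\<integral>\<^sup>+ w. (\<integral>\<^sup>+ x. F x w \<partial>?M) \<partial>?M)"
      by (rule MM.Fubini'[symmetric]) measurable
    also have "\<dots> \<le> (\<integral>\<^sup>+ w. epowr (K * (B w * g w)) Q \<partial>?M)"
    proof (intro nn_integral_mono)
      fix w assume "w \<in> space ?M"
      then have w: "w \<in> {0<..<T}" by (simp add: space_restrict_space)
      have "(\<integral>\<^sup>+ x. F x w \<partial>?M) = epowr (Lnorm q 0 T (\<lambda>x. ennreal (A x) * g w * indicator R (x, w))) Q"
        unfolding L'[symmetric] F_def epowr_mult epi ..
      also have "Lnorm q 0 T (\<lambda>x. ennreal (A x) * g w * indicator R (x, w)) \<le>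
          Lnorm q 0 T (\<lambda>x. (B w * g w) * (\<kappa> x w * indicator R (x, w)))"
      proof (intro Lnorm_mono q)
        show "(\<lambda>x. ennreal (A x) * g w * indicator R (x, w)) \<in> borel_measurable ?M"
          using w by measurable
        fix x assume x: "0 < x" "x < T"
        show "ennreal (A x) * g w * indicator R (x, w) \<le> (B w * g w) * (\<kappa> x w * indicator R (x, w))"
          using mult_right_mono[OF le[of x w], of "g w"] x w
          by (auto simp: indicator_def mult_ac)
      qed
      also have "\<dots> \<le> (B w * g w) * Lnorm q 0 T (\<lambda>x. \<kappa> x w * indicator R (x, w))"
        by (intro eq_refl Lnorm_cmult q \<kappa>)
      also have "\<dots> \<le> (B w * g w) * K"
        using 2 w by (intro mult_left_mono norm) auto
      finally show "(\<integral>\<^sup>+ x. F x w \<partial>?M) \<le> epowr (K * (B w * g w)) Q"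
        using Q by (simp add: epowr_le_iff mult_ac)
    qed
    finally have "Lnorm q 0 T (\<lambda>x. ennreal (A x) * N x)
        \<le> Lnorm q 0 T (\<lambda>w. K * (B w * g w))"
      unfolding L' using Q by (simp add: epowr_le_iff)
    also have "\<dots> \<le> K * Lnorm q 0 T (\<lambda>w. B w * g w)"
      by (intro eq_refl Lnorm_cmult q) measurable
    finally show ?thesis .
  qed
qed

lemma Lnorm_indicator_le:
  assumes "0 < q" "q \<noteq> \<infinity>"
  shows "Lnorm q a b (\<lambda>x. f x * indicator {c<..<d} x) \<le> Lnorm q c d f"
  using assms(1)
proof (cases rule: expo_cases)
  case (2 Q)
  then show ?thesis unfolding 2 Lnorm_real[OF \<open>0 < Q\<close>]
    by (intro epowr_mono nn_integral_mono) (auto simp: indicator_def)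
qed (use assms in simp)

section \<open>Measurability of monotone extended-valued functions\<close>

lemma borel_measurable_interval_levels:
  fixes f :: "real \<Rightarrow> ennreal"
  assumes "\<And>y. is_interval {x. y < f x}"
  shows "f \<in> borel_measurable borel"
  using assms by (intro borel_measurableI_greater) (auto intro: real_interval_borel_measurable)

lemma borel_measurable_mono_ennreal:
  fixes f :: "real \<Rightarrow> ennreal"
  shows "mono f \<Longrightarrow> f \<in> borel_measurable borel"
  by (intro borel_measurable_interval_levels) (auto simp: is_interval_1 mono_def intro: less_le_trans)

lemma borel_measurable_antimono_ennreal:
  fixes f :: "real \<Rightarrow> ennreal"
  shows "antimono f \<Longrightarrow> f \<in> borel_measurable borel"
  by (intro borel_measurable_interval_levels) (auto simp: is_interval_1 antimono_def intro: less_le_trans)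

text \<open>The norm grows with the interval, so it is monotone in the endpoint and hence measurable
  for arbitrary \<open>g\<close>.\<close>

lemma Lnorm_left_measurable:
  "0 < q \<Longrightarrow> (\<lambda>t. Lnorm q a t g) \<in> borel_measurable borel"
  by (intro borel_measurable_mono_ennreal monoI Lnorm_subinterval) auto

lemma Lnorm_right_measurable:
  "0 < q \<Longrightarrow> (\<lambda>t. Lnorm q t b g) \<in> borel_measurable borel"
  by (intro borel_measurable_antimono_ennreal antimonoI Lnorm_subinterval) auto

text \<open>The power \<open>w powr \<epsilon> * x powr (- \<epsilon> - recip q)\<close> is a kernel
  whose norm in \<open>x\<close> over (w,T) is bounded uniformly in \<open>w\<close> and
  \<open>T\<close>; \<open>B\<close> absorbs the remaining weights.\<close>

lemma hardy_left:
  assumes q: "0 < q" and \<epsilon>: "0 < \<epsilon>"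
  obtains K :: real where "0 < K"
    "\<And>C T A B g. 0 \<le> C \<Longrightarrow> A \<in> borel_measurable (lebesgue_on {0<..<T}) \<Longrightarrow>
      B \<in> borel_measurable (lebesgue_on {0<..<T}) \<Longrightarrow> g \<in> borel_measurable (lebesgue_on {0<..<T}) \<Longrightarrow>
      (\<And>x w. 0 < w \<Longrightarrow> w < x \<Longrightarrow> x < T \<Longrightarrow>
        ennreal (A x) \<le> ennreal (C * w powr \<epsilon> * x powr (- \<epsilon> - recip q)) * B w) \<Longrightarrow>
      Lnorm q 0 T (\<lambda>x. ennreal (A x) * Lnorm q 0 x g) \<le> ennreal (C * K) * Lnorm q 0 T (\<lambda>w. B w * g w)"
proof -
  obtain K0 where K0: "0 < K0"
    "\<And>u T. 0 < u \<Longrightarrow> Lnorm q u T (\<lambda>w. ennreal (w powr (- \<epsilon> - recip q))) \<le> ennreal (K0 * u powr (- \<epsilon>))"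
    using Lnorm_powr_upper[OF q \<epsilon>] by blast
  show thesis
  \<comment> \<open>\<open>K0\<close> bounds the norm of the kernel for finite \<open>q\<close>; for
    \<open>q = \<infinity>\<close> the kernel itself is at most \<open>C\<close>, which accounts for
    the 1.\<close>
  proof (rule that[of "max K0 1"])
    fix C T :: real and A :: "real \<Rightarrow> real" and B g :: "real \<Rightarrow> ennreal"
    assume C: "0 \<le> C" and meas: "A \<in> borel_measurable (lebesgue_on {0<..<T})"
      "B \<in> borel_measurable (lebesgue_on {0<..<T})" "g \<in> borel_measurable (lebesgue_on {0<..<T})"
      and le: "\<And>x w. 0 < w \<Longrightarrow> w < x \<Longrightarrow> x < T \<Longrightarrow>
        ennreal (A x) \<le> ennreal (C * w powr \<epsilon> * x powr (- \<epsilon> - recip q)) * B w"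
    let ?R = "{(x, w). w < x} :: (real \<times> real) set"
    let ?k = "\<lambda>x w. ennreal (C * w powr \<epsilon> * x powr (- \<epsilon> - recip q))"
    have "?R = {z. snd z < fst z}" by auto
    then have R: "?R \<in> sets borel"
      by (auto intro!: borel_open open_Collect_less continuous_intros)
    have indR: "indicator ?R (x, w) = (indicator {w<..} x :: ennreal)"
      "indicator ?R (x, w) = (indicator {..<x} w :: ennreal)" for x w
      by (auto simp: indicator_def)
    show "Lnorm q 0 T (\<lambda>x. ennreal (A x) * Lnorm q 0 x g) \<le> ennreal (C * max K0 1) * Lnorm q 0 T (\<lambda>w. B w * g w)"
    proof (rule hardy_kernel[OF q meas R, where \<kappa>="?k"])
      show "(\<lambda>x. ?k x w * indicator ?R (x, w)) \<in> borel_measurable (lebesgue_on {0<..<T})" for w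
        unfolding indR by (intro borel_lebesgue_on) measurable
      show "(\<lambda>x. Lnorm q 0 x g) \<in> borel_measurable (lebesgue_on {0<..<T})"
        by (intro borel_lebesgue_on Lnorm_left_measurable q)
      show "Lnorm q 0 x g \<le> Lnorm q 0 T (\<lambda>w. g w * indicator ?R (x, w))" if "x \<in> {0<..<T}" for x
      proof -
        have "Lnorm q 0 x g = Lnorm q 0 x (\<lambda>w. g w * indicator ?R (x, w))"
          by (intro Lnorm_cong) simp
        also have "\<dots> \<le> Lnorm q 0 T (\<lambda>w. g w * indicator ?R (x, w))"
          using that by (intro Lnorm_subinterval q) auto
        finally show ?thesis .
      qed
      show "ennreal (A x) \<le> ?k x w * B w" if "x \<in> {0<..<T}" "w \<in> {0<..<T}" "(x, w) \<in> ?R" for x w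
        using that by (intro le) auto
      show "?k x w \<le> ennreal (C * max K0 1)"
        if "q = \<infinity>" "x \<in> {0<..<T}" "w \<in> {0<..<T}" "(x, w) \<in> ?R" for x w
      proof (intro ennreal_leI)
        have "w powr \<epsilon> \<le> x powr \<epsilon>"
          using that \<epsilon> by (intro powr_mono2) auto
        then have "w powr \<epsilon> * x powr (- \<epsilon>) \<le> x powr \<epsilon> * x powr (- \<epsilon>)"
          by (intro mult_right_mono) auto
        also have "\<dots> = 1" using that by (simp flip: powr_add)
        also have "\<dots> \<le> max K0 1" by simp
        finally show "C * w powr \<epsilon> * x powr (- \<epsilon> - recip q) \<le> C * max K0 1"
          using that C by (simp add: mult.assoc mult_left_mono)
      qed
      show "Lnorm q 0 T (\<lambda>x. ?k x w * indicator ?R (x, w)) \<le> ennreal (C * max K0 1)"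
        if "q \<noteq> \<infinity>" "w \<in> {0<..<T}" for w
      proof -
        have "Lnorm q 0 T (\<lambda>x. ?k x w * indicator ?R (x, w)) = Lnorm q 0 T (\<lambda>x. ?k x w * indicator {w<..<T} x)"
          by (intro Lnorm_cong) (simp add: indicator_def)
        also have "\<dots> \<le> Lnorm q w T (\<lambda>x. ?k x w)"
          using that by (intro Lnorm_indicator_le q)
        also have "\<dots> = Lnorm q w T (\<lambda>x. ennreal (C * w powr \<epsilon>) * ennreal (x powr (- \<epsilon> - recip q)))"
          using C by (simp add: ennreal_mult')
        also have "\<dots> = ennreal (C * w powr \<epsilon>) * Lnorm q w T (\<lambda>x. ennreal (x powr (- \<epsilon> - recip q)))"
          by (intro Lnorm_cmult q powr_Lnorm_measurable)
        also have "\<dots> \<le> ennreal (C * w powr \<epsilon>) * ennreal (K0 * w powr (- \<epsilon>))"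
          using that by (intro mult_left_mono K0) auto
        also have "\<dots> = ennreal (C * K0)"
          using that C K0 by (simp add: mult_ac flip: ennreal_mult' powr_add)
        also have "\<dots> \<le> ennreal (C * max K0 1)"
          using C by (intro ennreal_leI mult_left_mono) auto
        finally show ?thesis .
      qed
    qed
  qed simp
qed

text \<open>Mirror image of \<open>hardy_left\<close>, with a kernel whose norm converges at the
  origin. Comparing \<open>A\<close> and \<open>B\<close> pointwise with a free constant
  \<open>C\<close> admits weights that are only almost monotone, as those containing
  \<open>b\<close>.\<close>

lemma hardy_right:
  assumes q: "0 < q" and \<epsilon>: "0 < \<epsilon>"
  obtains K :: real where "0 < K"
    "\<And>C T A B g. 0 \<le> C \<Longrightarrow> A \<in> borel_measurable (lebesgue_on {0<..<T}) \<Longrightarrow>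
      B \<in> borel_measurable (lebesgue_on {0<..<T}) \<Longrightarrow> g \<in> borel_measurable (lebesgue_on {0<..<T}) \<Longrightarrow>
      (\<And>x w. 0 < x \<Longrightarrow> x < w \<Longrightarrow> w < T \<Longrightarrow>
        ennreal (A x) \<le> ennreal (C * w powr (- \<epsilon>) * x powr (\<epsilon> - recip q)) * B w) \<Longrightarrow>
      Lnorm q 0 T (\<lambda>x. ennreal (A x) * Lnorm q x T g) \<le> ennreal (C * K) * Lnorm q 0 T (\<lambda>w. B w * g w)"
proof -
  obtain K0 where K0: "0 < K0"
    "\<And>u. 0 < u \<Longrightarrow> Lnorm q 0 u (\<lambda>w. ennreal (w powr (\<epsilon> - recip q))) \<le> ennreal (K0 * u powr \<epsilon>)"
    using Lnorm_powr_lower[OF q \<epsilon>] by blast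
  show thesis
  proof (rule that[of "max K0 1"])
    fix C T :: real and A :: "real \<Rightarrow> real" and B g :: "real \<Rightarrow> ennreal"
    assume C: "0 \<le> C" and meas: "A \<in> borel_measurable (lebesgue_on {0<..<T})"
      "B \<in> borel_measurable (lebesgue_on {0<..<T})" "g \<in> borel_measurable (lebesgue_on {0<..<T})"
      and le: "\<And>x w. 0 < x \<Longrightarrow> x < w \<Longrightarrow> w < T \<Longrightarrow>
        ennreal (A x) \<le> ennreal (C * w powr (- \<epsilon>) * x powr (\<epsilon> - recip q)) * B w"
    let ?R = "{(x, w). x < w} :: (real \<times> real) set"
    let ?k = "\<lambda>x w. ennreal (C * w powr (- \<epsilon>) * x powr (\<epsilon> - recip q))"
    have "?R = {z. fst z < snd z}" by auto
    then have R: "?R \<in> sets borel"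
      by (auto intro!: borel_open open_Collect_less continuous_intros)
    have indR: "indicator ?R (x, w) = (indicator {..<w} x :: ennreal)" for x w
      by (auto simp: indicator_def)
    show "Lnorm q 0 T (\<lambda>x. ennreal (A x) * Lnorm q x T g) \<le> ennreal (C * max K0 1) * Lnorm q 0 T (\<lambda>w. B w * g w)"
    proof (rule hardy_kernel[OF q meas R, where \<kappa>="?k"])
      show "(\<lambda>x. ?k x w * indicator ?R (x, w)) \<in> borel_measurable (lebesgue_on {0<..<T})" for w
        unfolding indR by (intro borel_lebesgue_on) measurable
      show "(\<lambda>x. Lnorm q x T g) \<in> borel_measurable (lebesgue_on {0<..<T})"
        by (intro borel_lebesgue_on Lnorm_right_measurable q)
      show "Lnorm q x T g \<le> Lnorm q 0 T (\<lambda>w. g w * indicator ?R (x, w))" if "x \<in> {0<..<T}" for x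
      proof -
        have "Lnorm q x T g = Lnorm q x T (\<lambda>w. g w * indicator ?R (x, w))"
          by (intro Lnorm_cong) simp
        also have "\<dots> \<le> Lnorm q 0 T (\<lambda>w. g w * indicator ?R (x, w))"
          using that by (intro Lnorm_subinterval q) auto
        finally show ?thesis .
      qed
      show "ennreal (A x) \<le> ?k x w * B w" if "x \<in> {0<..<T}" "w \<in> {0<..<T}" "(x, w) \<in> ?R" for x w
        using that by (intro le) auto
      show "?k x w \<le> ennreal (C * max K0 1)"
        if "q = \<infinity>" "x \<in> {0<..<T}" "w \<in> {0<..<T}" "(x, w) \<in> ?R" for x w
      proof (intro ennreal_leI)
        have "x powr \<epsilon> \<le> w powr \<epsilon>"
          using that \<epsilon> by (intro powr_mono2) auto
        then have "w powr (- \<epsilon>) * x powr \<epsilon> \<le> w powr (- \<epsilon>) * w powr \<epsilon>"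
          by (intro mult_left_mono) auto
        also have "\<dots> = 1" using that by (simp flip: powr_add)
        also have "\<dots> \<le> max K0 1" by simp
        finally show "C * w powr (- \<epsilon>) * x powr (\<epsilon> - recip q) \<le> C * max K0 1"
          using that C by (simp add: mult.assoc mult_left_mono)
      qed
      show "Lnorm q 0 T (\<lambda>x. ?k x w * indicator ?R (x, w)) \<le> ennreal (C * max K0 1)"
        if "q \<noteq> \<infinity>" "w \<in> {0<..<T}" for w
      proof -
        have "Lnorm q 0 T (\<lambda>x. ?k x w * indicator ?R (x, w)) = Lnorm q 0 T (\<lambda>x. ?k x w * indicator {0<..<w} x)"
          by (intro Lnorm_cong) (simp add: indicator_def)
        also have "\<dots> \<le> Lnorm q 0 w (\<lambda>x. ?k x w)"
          using that by (intro Lnorm_indicator_le q)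
        also have "\<dots> = Lnorm q 0 w (\<lambda>x. ennreal (C * w powr (- \<epsilon>)) * ennreal (x powr (\<epsilon> - recip q)))"
          using C by (simp add: ennreal_mult')
        also have "\<dots> = ennreal (C * w powr (- \<epsilon>)) * Lnorm q 0 w (\<lambda>x. ennreal (x powr (\<epsilon> - recip q)))"
          by (intro Lnorm_cmult q powr_Lnorm_measurable)
        also have "\<dots> \<le> ennreal (C * w powr (- \<epsilon>)) * ennreal (K0 * w powr \<epsilon>)"
          using that by (intro mult_left_mono K0) auto
        also have "\<dots> = ennreal (C * K0)"
          using that C K0 by (simp add: mult_ac flip: ennreal_mult' powr_add)
        also have "\<dots> \<le> ennreal (C * max K0 1)"
          using C by (intro ennreal_leI mult_left_mono) auto
        finally show ?thesis .
      qed
    qed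
  qed simp
qed

section \<open>Averages of non-increasing functions\<close>

lemma powr_shift_le:
  assumes "ennreal (v powr a) * y \<le> z" "0 < v" "d = a + e"
  shows "ennreal (v powr d) * y \<le> z * ennreal (v powr e)"
proof -
  have "ennreal (v powr d) * y = (ennreal (v powr a) * y) * ennreal (v powr e)"
    using assms by (simp add: powr_add ennreal_mult' mult_ac)
  also have "\<dots> \<le> z * ennreal (v powr e)"
    using assms(1) by (rule mult_right_mono) simp
  finally show ?thesis .
qed

lemma powr_mult_measurable:
  "h \<in> borel_measurable (lebesgue_on S) \<Longrightarrow> (\<lambda>w. ennreal (w powr a) * h w) \<in> borel_measurable (lebesgue_on S)"
  by (intro borel_measurable_times_ennreal powr_Lnorm_measurable)

text \<open>On the block (v/2,v) a non-increasing \<open>h\<close> is at least \<open>h v\<close>,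
  which leaves the dyadic bound for the bare power.\<close>

lemma antimono_le_Lnorm:
  assumes "0 < q"
  obtains C :: real where "0 < C"
    "\<And>h v. antimono h \<Longrightarrow> 0 < v \<Longrightarrow> ennreal (v powr a) * h v \<le>
      ennreal C * Lnorm q (v / 2) v (\<lambda>w. ennreal (w powr (a - recip q)) * h w)"
proof -
  obtain c where c: "0 < c"
    "\<And>v. 0 < v \<Longrightarrow> ennreal (c * v powr a) \<le> Lnorm q (v / 2) v (\<lambda>w. ennreal (w powr (a - recip q)))"
    using Lnorm_powr_dyadic[OF assms] by blast
  show thesis
  proof (rule that[of "1 / c"])
    fix h :: "real \<Rightarrow> ennreal" and v :: real
    assume h: "antimono h" and v: "0 < v"
    have "ennreal (v powr a) * h v = ennreal (1 / c) * (h v * ennreal (c * v powr a))"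
      using c by (simp add: mult_ac flip: mult.assoc ennreal_mult')
    also have "\<dots> \<le> ennreal (1 / c) * (h v * Lnorm q (v / 2) v (\<lambda>w. ennreal (w powr (a - recip q))))"
      using v by (intro mult_left_mono c) auto
    also have "\<dots> = ennreal (1 / c) * Lnorm q (v / 2) v (\<lambda>w. h v * ennreal (w powr (a - recip q)))"
      by (simp add: Lnorm_cmult[OF assms powr_Lnorm_measurable])
    also have "\<dots> \<le> ennreal (1 / c) * Lnorm q (v / 2) v (\<lambda>w. ennreal (w powr (a - recip q)) * h w)"
    proof (intro mult_left_mono Lnorm_mono assms)
      show "(\<lambda>w. h v * ennreal (w powr (a - recip q))) \<in> borel_measurable (lebesgue_on {v / 2<..<v})"
        by (intro borel_measurable_times_ennreal powr_Lnorm_measurable) auto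
      show "h v * ennreal (w powr (a - recip q)) \<le> ennreal (w powr (a - recip q)) * h w" if "w < v" for w
        using h that by (subst mult.commute) (auto intro!: mult_left_mono simp: antimono_def)
    qed simp
    finally show "ennreal (v powr a) * h v \<le>
      ennreal (1 / c) * Lnorm q (v / 2) v (\<lambda>w. ennreal (w powr (a - recip q)) * h w)" .
  qed (use c in simp)
qed

text \<open>The dyadic estimate bounds \<open>v powr a * h v\<close> by the whole norm over (0,u),
  which is constant in \<open>v\<close>. What remains is a power of positive degree
  \<open>a0 - a\<close>, whose norm near the origin is finite for every \<open>W\<close>.\<close>

lemma upper_average_le:
  assumes q: "0 < q" and W: "0 < W" and a: "a < a0"
  obtains C :: real where "0 < C"
    "\<And>h u. antimono h \<Longrightarrow> 0 < u \<Longrightarrow>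
      Lnorm W 0 u (\<lambda>v. ennreal (v powr (a0 - recip W)) * h v) \<le>
      ennreal (C * u powr (a0 - a)) * Lnorm q 0 u (\<lambda>w. ennreal (w powr (a - recip q)) * h w)"
proof -
  obtain C1 where C1: "0 < C1"
    "\<And>h v. antimono h \<Longrightarrow> 0 < v \<Longrightarrow> ennreal (v powr a) * h v \<le>
      ennreal C1 * Lnorm q (v / 2) v (\<lambda>w. ennreal (w powr (a - recip q)) * h w)"
    using antimono_le_Lnorm[OF q] by blast
  have "0 < a0 - a" using a by simp
  from Lnorm_powr_lower[OF W this] obtain C2 where C2: "0 < C2"
    "\<And>u. 0 < u \<Longrightarrow> Lnorm W 0 u (\<lambda>w. ennreal (w powr (a0 - a - recip W))) \<le> ennreal (C2 * u powr (a0 - a))"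
    by blast
  show thesis
  proof (rule that[of "C1 * C2"])
    fix h :: "real \<Rightarrow> ennreal" and u :: real
    assume h: "antimono h" and u: "0 < u"
    let ?K = "Lnorm q 0 u (\<lambda>w. ennreal (w powr (a - recip q)) * h w)"
    have "Lnorm W 0 u (\<lambda>v. ennreal (v powr (a0 - recip W)) * h v) \<le>
        Lnorm W 0 u (\<lambda>v. (ennreal C1 * ?K) * ennreal (v powr (a0 - a - recip W)))"
    proof (intro Lnorm_mono W powr_mult_measurable borel_lebesgue_on borel_measurable_antimono_ennreal h)
      fix v assume v: "0 < v" "v < u"
      have "ennreal (v powr a) * h v \<le> ennreal C1 * Lnorm q (v / 2) v (\<lambda>w. ennreal (w powr (a - recip q)) * h w)"
        using v by (intro C1 h)
      also have "\<dots> \<le> ennreal C1 * ?K"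
        using v by (intro mult_left_mono Lnorm_subinterval q) auto
      finally show "ennreal (v powr (a0 - recip W)) * h v \<le> (ennreal C1 * ?K) * ennreal (v powr (a0 - a - recip W))"
        using v by (intro powr_shift_le[of v a]) auto
    qed
    also have "\<dots> = (ennreal C1 * ?K) * Lnorm W 0 u (\<lambda>v. ennreal (v powr (a0 - a - recip W)))"
      by (intro Lnorm_cmult W powr_Lnorm_measurable)
    also have "\<dots> \<le> (ennreal C1 * ?K) * ennreal (C2 * u powr (a0 - a))"
      using u by (intro mult_left_mono C2) auto
    also have "\<dots> = ennreal (C1 * C2 * u powr (a0 - a)) * ?K"
      using C1 C2 by (simp add: ennreal_mult' mult_ac)
    finally show "Lnorm W 0 u (\<lambda>v. ennreal (v powr (a0 - recip W)) * h v) \<le>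
      ennreal (C1 * C2 * u powr (a0 - a)) * ?K" .
  qed (use C1 C2 in simp)
qed

text \<open>As for the upper average, but the remaining degree \<open>a0 - a\<close> is negative,
  which makes the norm over (u,T) bounded uniformly in \<open>T\<close>. The separate value at
  \<open>u\<close> repairs an effect at the left end.\<close>

lemma lower_average_le:
  assumes q: "0 < q" and W: "0 < W" and a: "a0 < a" "0 \<le> a"
  obtains C :: real where "0 < C"
    "\<And>h u T. antimono h \<Longrightarrow> 0 < u \<Longrightarrow>
      Lnorm W u T (\<lambda>v. ennreal (v powr (a0 - recip W)) * h v) \<le>
      ennreal (C * u powr (a0 - a)) * (ennreal (u powr a) * h u + Lnorm q u T (\<lambda>w. ennreal (w powr (a - recip q)) * h w))"
proof -
  obtain C1 where C1: "0 < C1"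
    "\<And>h v. antimono h \<Longrightarrow> 0 < v \<Longrightarrow> ennreal (v powr a) * h v \<le>
      ennreal C1 * Lnorm q (v / 2) v (\<lambda>w. ennreal (w powr (a - recip q)) * h w)"
    using antimono_le_Lnorm[OF q] by blast
  have "0 < a - a0" using a by simp
  from Lnorm_powr_upper[OF W this] obtain C2 where C2: "0 < C2"
    "\<And>u T. 0 < u \<Longrightarrow> Lnorm W u T (\<lambda>w. ennreal (w powr (a0 - a - recip W))) \<le> ennreal (C2 * u powr (a0 - a))"
    by auto
  define C3 where "C3 = max C1 (2 powr a)"
  have C3: "0 < C3" "C1 \<le> C3" "2 powr a \<le> C3" using C1 by (auto simp: C3_def)
  show thesis
  proof (rule that[of "C3 * C2"])
    fix h :: "real \<Rightarrow> ennreal" and u T :: real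
    assume h: "antimono h" and u: "0 < u"
    let ?K = "Lnorm q u T (\<lambda>w. ennreal (w powr (a - recip q)) * h w)"
    let ?S = "ennreal (u powr a) * h u + ?K"
    have "Lnorm W u T (\<lambda>v. ennreal (v powr (a0 - recip W)) * h v) \<le>
        Lnorm W u T (\<lambda>v. (ennreal C3 * ?S) * ennreal (v powr (a0 - a - recip W)))"
    proof (intro Lnorm_mono W powr_mult_measurable borel_lebesgue_on borel_measurable_antimono_ennreal h)
      fix v assume v: "u < v" "v < T"
      have "ennreal (v powr a) * h v \<le> ennreal C3 * ?S"
      \<comment> \<open>For \<open>v < 2 * u\<close> the block (v/2,v) sticks out of (u,T) to the
        left; there \<open>h v \<le> h u\<close> is used directly, at the price of the factor
        \<open>2 powr a\<close>.\<close>
      proof (cases "v < 2 * u")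
        case True
        have "v powr a \<le> (2 * u) powr a"
          using True v u a by (intro powr_mono2) auto
        also have "\<dots> = 2 powr a * u powr a"
          using u by (simp add: powr_mult)
        also have "\<dots> \<le> C3 * u powr a"
          using C3 by (intro mult_right_mono) auto
        finally have "ennreal (v powr a) * h v \<le> ennreal (C3 * u powr a) * h u"
          using h v by (intro mult_mono ennreal_leI) (auto simp: antimono_def)
        also have "\<dots> = ennreal C3 * (ennreal (u powr a) * h u)"
          using C3 by (simp add: ennreal_mult' mult.assoc)
        also have "\<dots> \<le> ennreal C3 * ?S"
          by (intro mult_left_mono) auto
        finally show ?thesis .
      next
        case False
        have "ennreal (v powr a) * h v \<le> ennreal C1 * Lnorm q (v / 2) v (\<lambda>w. ennreal (w powr (a - recip q)) * h w)"
          using v u by (intro C1 h) auto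
        also have "\<dots> \<le> ennreal C1 * ?K"
          using v False by (intro mult_left_mono Lnorm_subinterval q) auto
        also have "\<dots> \<le> ennreal C3 * ?S"
          using C3 by (intro mult_mono ennreal_leI) auto
        finally show ?thesis .
      qed
      then show "ennreal (v powr (a0 - recip W)) * h v \<le> (ennreal C3 * ?S) * ennreal (v powr (a0 - a - recip W))"
        using u v by (intro powr_shift_le[of v a]) auto
    qed
    also have "\<dots> = (ennreal C3 * ?S) * Lnorm W u T (\<lambda>v. ennreal (v powr (a0 - a - recip W)))"
      by (intro Lnorm_cmult W powr_Lnorm_measurable)
    also have "\<dots> \<le> (ennreal C3 * ?S) * ennreal (C2 * u powr (a0 - a))"
      using u by (intro mult_left_mono C2) auto
    also have "\<dots> = ennreal (C3 * C2 * u powr (a0 - a)) * ?S"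
      using C3 C2 by (simp add: ennreal_mult' mult_ac)
    finally show "Lnorm W u T (\<lambda>v. ennreal (v powr (a0 - recip W)) * h v) \<le>
      ennreal (C3 * C2 * u powr (a0 - a)) * ?S" .
  qed (use C3 C2 in simp)
qed

section \<open>Rearrangements and slowly varying functions\<close>

lemma rearr_antimono: "antimono (rearr f)"
  unfolding rearr_def
  by (intro antimonoI Inf_superset_mono image_mono) (auto intro: order_trans ennreal_leI)

lemma rearr_borel: "rearr f \<in> borel_measurable borel"
  by (intro borel_measurable_antimono_ennreal rearr_antimono)

text \<open>The levels in the infimum are positive, so 0 is only approached. Vanishing beyond 1 is
  what lets a dilated rearrangement leave the unit interval.\<close>

lemma rearr_eq_0:
  assumes "1 \<le> t" shows "rearr f t = 0"
proof -
  have "rearr f t \<le> 0 + ennreal e" if "0 < e" for e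
  proof -
    have "emeasure lebesgue {x \<in> {0<..<1}. e < cmod (f x)} \<le> emeasure lebesgue {0<..<1::real}"
      by (intro emeasure_mono) auto
    also have "\<dots> \<le> ennreal t" using assms by simp
    finally have "rearr f t \<le> ennreal e"
      using that unfolding rearr_def by (intro Inf_lower imageI CollectI conjI)
    then show ?thesis by simp
  qed
  then have "rearr f t \<le> 0" by (rule ennreal_le_epsilon)
  then show ?thesis by simp
qed

lemma rearr_powr:
  assumes a: "0 \<le> a" and t: "0 < t" "t < 1"
  shows "rearr (\<lambda>x. complex_of_real (x powr (- a))) t = ennreal (t powr (- a))"
proof (rule antisym)
  have "{x \<in> {0<..<1}. t powr (- a) < cmod (complex_of_real (x powr (- a)))} \<subseteq> {0<..<t}"
  proof safe
    fix x :: real assume x: "x \<in> {0<..<1}" "t powr (- a) < cmod (complex_of_real (x powr (- a)))"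
    then show "x \<in> {0<..<t}" using a t powr_mono2'[of "- a" t x] by (cases "x < t") auto
  qed
  then have "emeasure lebesgue {x \<in> {0<..<1}. t powr (- a) < cmod (complex_of_real (x powr (- a)))}
      \<le> emeasure lebesgue {0<..<t}"
    by (intro emeasure_mono) auto
  also have "\<dots> = ennreal t" using t by simp
  finally show "rearr (\<lambda>x. complex_of_real (x powr (- a))) t \<le> ennreal (t powr (- a))"
    using t unfolding rearr_def by (intro Inf_lower imageI CollectI conjI) simp_all
next
  show "ennreal (t powr (- a)) \<le> rearr (\<lambda>x. complex_of_real (x powr (- a))) t"
    unfolding rearr_def
  proof (safe intro!: Inf_greatest ennreal_leI)
    fix s :: real assume s: "0 < s"
      "emeasure lebesgue {x \<in> {0<..<1}. s < cmod (complex_of_real (x powr (- a)))} \<le> ennreal t"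
    show "t powr (- a) \<le> s"
    proof (rule ccontr)
      assume "\<not> t powr (- a) \<le> s"
      then have less: "s < t powr (- a)" by simp
      \<comment> \<open>The level set must have measure strictly larger than \<open>t\<close>.
        Continuity from the right provides a point \<open>y > t\<close> such that (0,y) still lies
        above the level \<open>s\<close>.\<close>
      have "((\<lambda>x. x powr (- a)) \<longlongrightarrow> t powr (- a)) (at_right t)"
        using t by (intro tendsto_intros) auto
      then have "eventually (\<lambda>x. s < x powr (- a)) (at_right t)"
        using less by (rule order_tendstoD)
      then obtain b where b: "t < b" "\<And>y. t < y \<Longrightarrow> y < b \<Longrightarrow> s < y powr (- a)"
        unfolding eventually_at_right_field by blast
      define y where "y = (t + min b 1) / 2"
      have y: "t < y" "y < b" "y < 1" using b t by (auto simp: y_def min_def)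
      have "{0<..<y} \<subseteq> {x \<in> {0<..<1}. s < cmod (complex_of_real (x powr (- a)))}"
      proof safe
        fix x assume x: "x \<in> {0<..<y}"
        then have "y powr (- a) \<le> x powr (- a)" using a by (intro powr_mono2') auto
        with b(2)[OF y(1,2)] show "s < cmod (complex_of_real (x powr (- a)))" by simp
        show "x \<in> {0<..<1}" using x y by auto
      qed
      moreover have "{x \<in> {0<..<1}. s < cmod (complex_of_real (x powr (- a)))} \<in> sets borel"
        by measurable
      then have "{x \<in> {0<..<1}. s < cmod (complex_of_real (x powr (- a)))} \<in> sets lebesgue"
        by (simp only: sets_completionI_sets sets_lborel)
      ultimately have "emeasure lebesgue {0<..<y} \<le> emeasure lebesgue {x \<in> {0<..<1}. s < cmod (complex_of_real (x powr (- a)))}"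
        by (intro emeasure_mono)
      with s(2) have "ennreal y \<le> ennreal t" using t y by (simp add: order_trans)
      then show False using y t by simp
    qed
  qed
qed

lemma powr_complex_in_M01: "(\<lambda>x. complex_of_real (x powr a)) \<in> M01"
  unfolding M01_def by (intro borel_lebesgue_on) measurable

section \<open>Almost monotonicity of slowly varying functions\<close>

lemma SV01_mono:
  assumes "b \<in> SV01" "0 < \<eta>"
  obtains C :: real where "0 < C"
    "\<And>x w. 0 < x \<Longrightarrow> x \<le> w \<Longrightarrow> w < 1 \<Longrightarrow> x powr \<eta> * b x \<le> C * (w powr \<eta> * b w)"
proof -
  obtain \<phi> where mono: "mono_on {0<..<1} \<phi>"
    and "equiv_on {0<..<1} (\<lambda>t. ennreal (t powr \<eta> * b t)) \<phi>"
    using assms by (auto simp: SV01_def)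
  then obtain c C where cC: "0 < c" "c \<le> C"
    and c: "\<And>x. x \<in> {0<..<1} \<Longrightarrow> ennreal c * \<phi> x \<le> ennreal (x powr \<eta> * b x)"
    and C: "\<And>x. x \<in> {0<..<1} \<Longrightarrow> ennreal (x powr \<eta> * b x) \<le> ennreal C * \<phi> x"
    unfolding equiv_on_def by blast
  have pos: "0 < b x" if "x \<in> {0<..<1}" for x
    using assms that by (auto simp: SV01_def)
  show thesis
  \<comment> \<open>Passing from \<open>b\<close> to \<open>\<phi>\<close> costs \<open>C\<close>
    and returning costs \<open>1 / c\<close>; afterwards \<open>\<phi>\<close> is no longer
    mentioned.\<close>
  proof (rule that[of "C / c"])
    fix x w :: real assume xw: "0 < x" "x \<le> w" "w < 1"
    have "ennreal (x powr \<eta> * b x) \<le> ennreal C * \<phi> x" using xw by (intro C) auto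
    also have "\<dots> \<le> ennreal C * \<phi> w"
      using xw by (intro mult_left_mono mono_onD[OF mono]) auto
    also have "\<dots> = ennreal (C / c) * (ennreal c * \<phi> w)"
      using cC by (simp flip: mult.assoc ennreal_mult')
    also have "\<dots> \<le> ennreal (C / c) * ennreal (w powr \<eta> * b w)"
      using xw by (intro mult_left_mono c) auto
    also have "\<dots> = ennreal (C / c * (w powr \<eta> * b w))"
      using cC by (subst ennreal_mult'') (use pos[of w] xw in auto)
    finally show "x powr \<eta> * b x \<le> C / c * (w powr \<eta> * b w)"
      using cC xw pos[of w] by (subst (asm) ennreal_le_iff) auto
  qed (use cC in simp)
qed

lemma SV01_antimono:
  assumes "b \<in> SV01" "0 < \<eta>"
  obtains C :: real where "0 < C"
    "\<And>x w. 0 < x \<Longrightarrow> x \<le> w \<Longrightarrow> w < 1 \<Longrightarrow> w powr (- \<eta>) * b w \<le> C * (x powr (- \<eta>) * b x)"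
proof -
  obtain \<phi> where mono: "antimono_on {0<..<1} \<phi>"
    and "equiv_on {0<..<1} (\<lambda>t. ennreal (t powr (- \<eta>) * b t)) \<phi>"
    using assms by (auto simp: SV01_def)
  then obtain c C where cC: "0 < c" "c \<le> C"
    and c: "\<And>x. x \<in> {0<..<1} \<Longrightarrow> ennreal c * \<phi> x \<le> ennreal (x powr (- \<eta>) * b x)"
    and C: "\<And>x. x \<in> {0<..<1} \<Longrightarrow> ennreal (x powr (- \<eta>) * b x) \<le> ennreal C * \<phi> x"
    unfolding equiv_on_def by blast
  have pos: "0 < b x" if "x \<in> {0<..<1}" for x
    using assms that by (auto simp: SV01_def)
  show thesis
  proof (rule that[of "C / c"])
    fix x w :: real assume xw: "0 < x" "x \<le> w" "w < 1"
    have "ennreal (w powr (- \<eta>) * b w) \<le> ennreal C * \<phi> w" using xw by (intro C) auto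
    also have "\<dots> \<le> ennreal C * \<phi> x"
      using xw by (intro mult_left_mono monotone_onD[OF mono]) auto
    also have "\<dots> = ennreal (C / c) * (ennreal c * \<phi> x)"
      using cC by (simp flip: mult.assoc ennreal_mult')
    also have "\<dots> \<le> ennreal (C / c) * ennreal (x powr (- \<eta>) * b x)"
      using xw by (intro mult_left_mono c) auto
    also have "\<dots> = ennreal (C / c * (x powr (- \<eta>) * b x))"
      using cC by (subst ennreal_mult'') (use pos[of x] xw in auto)
    finally show "w powr (- \<eta>) * b w \<le> C / c * (x powr (- \<eta>) * b x)"
      using cC xw pos[of x] by (subst (asm) ennreal_le_iff) auto
  qed (use cC in simp)
qed

section \<open>Boundedness of the averaging operators\<close>

lemma Lnorm_weighted_le:
  assumes q: "0 < q" and g: "g \<in> borel_measurable borel" "g' \<in> borel_measurable borel"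
    and le: "\<And>u. a < u \<Longrightarrow> u < t \<Longrightarrow> g u \<le> C * g' u"
  shows "Lnorm q a t (\<lambda>u. ennreal (u powr d) * g u) \<le> C * Lnorm q a t (\<lambda>u. ennreal (u powr d) * g' u)"
proof -
  have "Lnorm q a t (\<lambda>u. ennreal (u powr d) * g u) \<le> Lnorm q a t (\<lambda>u. C * (ennreal (u powr d) * g' u))"
  proof (intro Lnorm_mono q powr_mult_measurable borel_lebesgue_on g)
    fix u assume "a < u" "u < t"
    then have "ennreal (u powr d) * g u \<le> ennreal (u powr d) * (C * g' u)"
      by (intro mult_left_mono le) auto
    then show "ennreal (u powr d) * g u \<le> C * (ennreal (u powr d) * g' u)"
      by (simp add: mult_ac)
  qed
  also have "\<dots> = C * Lnorm q a t (\<lambda>u. ennreal (u powr d) * g' u)"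
    by (intro Lnorm_cmult q powr_mult_measurable borel_lebesgue_on g)
  finally show ?thesis .
qed

lemma SV01_measurable:
  assumes "b \<in> SV01"
  shows "(\<lambda>t. t powr d * b t) \<in> borel_measurable (lebesgue_on {0<..<1})"
  using assms unfolding SV01_def
  by (intro borel_measurable_times) (auto intro!: borel_lebesgue_on)

lemma SV01_pos: "b \<in> SV01 \<Longrightarrow> 0 < t \<Longrightarrow> t < 1 \<Longrightarrow> 0 < b t"
  by (simp add: SV01_def)

lemma SV01_weight_measurable:
  assumes "b \<in> SV01" "g \<in> borel_measurable borel"
  shows "(\<lambda>t. ennreal (t powr d * b t) * g t) \<in> borel_measurable (lebesgue_on {0<..<1})"
  by (intro borel_measurable_times_ennreal measurable_compose[OF SV01_measurable]
      measurable_ennreal borel_lebesgue_on assms)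

text \<open>Reduces an estimate to the inner norms at each fixed \<open>t\<close>. Only the upper
  bound for the average over (t,1) cannot be obtained in this way: already for the constant function
  1 it fails with a constant uniform in \<open>t\<close>.\<close>

lemma Bnorm_le:
  assumes b: "b \<in> SV01" and q: "0 < q" and r: "0 < r"
    and le: "\<And>t. 0 < t \<Longrightarrow> t < 1 \<Longrightarrow>
      Lnorm q 0 t (\<lambda>u. ennreal (u powr (recip p - recip q)) * g u) \<le>
      C * Lnorm q 0 t (\<lambda>u. ennreal (u powr (recip p - recip q)) * g' u)"
  shows "Bnorm b p q r g \<le> C * Bnorm b p q r g'"
proof -
  let ?I = "\<lambda>g t. Lnorm q 0 t (\<lambda>u. ennreal (u powr (recip p - recip q)) * g u)"
  have "Bnorm b p q r g \<le> Lnorm r 0 1 (\<lambda>t. C * (ennreal (t powr (- recip r) * b t) * ?I g' t))"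
    unfolding Bnorm_def
  proof (intro Lnorm_mono r SV01_weight_measurable b Lnorm_left_measurable q)
    fix t :: real assume "0 < t" "t < 1"
    then have "ennreal (t powr (- recip r) * b t) * ?I g t \<le> ennreal (t powr (- recip r) * b t) * (C * ?I g' t)"
      by (intro mult_left_mono le) auto
    then show "ennreal (t powr (- recip r) * b t) * ?I g t \<le> C * (ennreal (t powr (- recip r) * b t) * ?I g' t)"
      by (simp add: mult_ac)
  qed
  also have "\<dots> = C * Bnorm b p q r g'"
    unfolding Bnorm_def by (intro Lnorm_cmult r SV01_weight_measurable b Lnorm_left_measurable q)
  finally show ?thesis .
qed

lemma H_upper_measurable: "0 < W \<Longrightarrow> H_upper U W f \<in> borel_measurable borel"
  unfolding H_upper_def by (intro borel_measurable_times_ennreal Lnorm_left_measurable) auto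

lemma H_lower_measurable: "0 < W \<Longrightarrow> H_lower V W f \<in> borel_measurable borel"
  unfolding H_lower_def by (intro borel_measurable_times_ennreal Lnorm_right_measurable) auto

section \<open>Comparison of the averages with the rearrangement\<close>

lemma rearr_le_H_upper:
  assumes W: "0 < W"
  obtains C :: real where "0 < C" "\<And>f u. 0 < u \<Longrightarrow> rearr f u \<le> ennreal C * H_upper U W f u"
proof -
  obtain C where C: "0 < C"
    "\<And>h v. antimono h \<Longrightarrow> 0 < v \<Longrightarrow> ennreal (v powr recip U) * h v \<le>
      ennreal C * Lnorm W (v / 2) v (\<lambda>w. ennreal (w powr (recip U - recip W)) * h w)"
    using antimono_le_Lnorm[OF W] by blast
  show thesis
  proof (rule that[of C])
    fix f and u :: real assume u: "0 < u"
    let ?g = "\<lambda>w. ennreal (w powr (recip U - recip W)) * rearr f w"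
    have "ennreal (u powr recip U) * rearr f u \<le> ennreal C * Lnorm W (u / 2) u ?g"
      using u by (intro C rearr_antimono)
    also have "\<dots> \<le> ennreal C * Lnorm W 0 u ?g"
      using u by (intro mult_left_mono Lnorm_subinterval W) auto
    finally have "ennreal (u powr 0) * rearr f u \<le> (ennreal C * Lnorm W 0 u ?g) * ennreal (u powr (- recip U))"
      using u by (rule powr_shift_le) simp
    then show "rearr f u \<le> ennreal C * H_upper U W f u"
      using u by (simp add: H_upper_def mult_ac)
  qed fact
qed

text \<open>The average starts at \<open>u\<close>, and the first dyadic block inside its range is
  (u,2u), whose values are at least the one at \<open>2 * u\<close>. If that point is not below 1,
  the rearrangement vanishes there.\<close>

lemma rearr_le_H_lower:
  assumes W: "0 < W"
  obtains C :: real where "0 < C" "\<And>f u. 0 < u \<Longrightarrow> rearr f (2 * u) \<le> ennreal C * H_lower V W f u"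
proof -
  obtain C where C: "0 < C"
    "\<And>h v. antimono h \<Longrightarrow> 0 < v \<Longrightarrow> ennreal (v powr recip V) * h v \<le>
      ennreal C * Lnorm W (v / 2) v (\<lambda>w. ennreal (w powr (recip V - recip W)) * h w)"
    using antimono_le_Lnorm[OF W] by blast
  show thesis
  proof (rule that[of C])
    fix f and u :: real assume u: "0 < u"
    let ?g = "\<lambda>w. ennreal (w powr (recip V - recip W)) * rearr f w"
    show "rearr f (2 * u) \<le> ennreal C * H_lower V W f u"
    proof (cases "2 * u < 1")
      case True
      have "ennreal ((2 * u) powr recip V) * rearr f (2 * u) \<le> ennreal C * Lnorm W (2 * u / 2) (2 * u) ?g"
        using u by (intro C rearr_antimono) simp
      also have "\<dots> \<le> ennreal C * Lnorm W u 1 ?g"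
        using u True by (intro mult_left_mono Lnorm_subinterval W) auto
      finally have "ennreal ((2 * u) powr 0) * rearr f (2 * u) \<le>
          (ennreal C * Lnorm W u 1 ?g) * ennreal ((2 * u) powr (- recip V))"
        using u by (intro powr_shift_le[of "2 * u" "recip V"]) auto
      also have "\<dots> \<le> (ennreal C * Lnorm W u 1 ?g) * ennreal (u powr (- recip V))"
        using u by (intro mult_left_mono ennreal_leI powr_mono2') auto
      finally show ?thesis
        using u by (simp add: H_lower_def mult_ac)
    qed (simp add: rearr_eq_0)
  qed fact
qed

lemma H_upper_inner_le:
  assumes q: "0 < q" and W: "0 < W" and less: "\<alpha> < recip U"
  obtains C :: real where "0 < C"
    "\<And>f t. Lnorm q 0 t (\<lambda>u. ennreal (u powr (\<alpha> - recip q)) * H_upper U W f u) \<le>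
      ennreal C * Lnorm q 0 t (\<lambda>u. ennreal (u powr (\<alpha> - recip q)) * rearr f u)"
proof -
  \<comment> \<open>Of the two gaps, \<open>a < recip U\<close> pays for trading \<open>W\<close>
    for \<open>q\<close>, and \<open>\<alpha> < a\<close> is the gap of the Hardy
    inequality.\<close>
  define a where "a = (\<alpha> + recip U) / 2"
  have a: "\<alpha> < a" "a < recip U" using less by (auto simp: a_def)
  obtain C1 where C1: "0 < C1"
    "\<And>h u. antimono h \<Longrightarrow> 0 < u \<Longrightarrow>
      Lnorm W 0 u (\<lambda>v. ennreal (v powr (recip U - recip W)) * h v) \<le>
      ennreal (C1 * u powr (recip U - a)) * Lnorm q 0 u (\<lambda>w. ennreal (w powr (a - recip q)) * h w)"
    using upper_average_le[OF q W a(2)] by blast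
  have pos: "0 < a - \<alpha>" using a by simp
  show thesis
  proof (rule hardy_left[OF q pos], goal_cases)
    case K: (1 K)
    show thesis
  proof (rule that[of "C1 * K"])
    fix f and t :: real
    let ?h = "rearr f"
    note [measurable] = rearr_borel[of f]
    let ?g = "\<lambda>w. ennreal (w powr (a - recip q)) * ?h w"
    have "Lnorm q 0 t (\<lambda>u. ennreal (u powr (\<alpha> - recip q)) * H_upper U W f u) \<le>
        Lnorm q 0 t (\<lambda>u. ennreal C1 * (ennreal (u powr (\<alpha> - a - recip q)) * Lnorm q 0 u ?g))"
    proof (intro Lnorm_mono q powr_mult_measurable borel_lebesgue_on H_upper_measurable W)
      fix u assume u: "0 < u" "u < t"
      have "ennreal (u powr (\<alpha> - recip q)) * H_upper U W f u \<le>
          ennreal (u powr (\<alpha> - recip q)) * (ennreal (u powr (- recip U)) * (ennreal (C1 * u powr (recip U - a)) * Lnorm q 0 u ?g))"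
        unfolding H_upper_def using u by (intro mult_left_mono C1 rearr_antimono) auto
      also have "\<dots> = ennreal C1 * (ennreal (u powr (\<alpha> - recip q) * u powr (- recip U) * u powr (recip U - a)) * Lnorm q 0 u ?g)"
        using C1 by (simp add: ennreal_mult' mult_ac)
      also have "u powr (\<alpha> - recip q) * u powr (- recip U) * u powr (recip U - a) = u powr (\<alpha> - a - recip q)"
        using u by (simp add: algebra_simps flip: powr_add)
      finally show "ennreal (u powr (\<alpha> - recip q)) * H_upper U W f u \<le>
          ennreal C1 * (ennreal (u powr (\<alpha> - a - recip q)) * Lnorm q 0 u ?g)" .
    qed
    also have "\<dots> = ennreal C1 * Lnorm q 0 t (\<lambda>u. ennreal (u powr (\<alpha> - a - recip q)) * Lnorm q 0 u ?g)"
      by (intro Lnorm_cmult powr_mult_measurable borel_lebesgue_on Lnorm_left_measurable q)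
    also have "Lnorm q 0 t (\<lambda>u. ennreal (u powr (\<alpha> - a - recip q)) * Lnorm q 0 u ?g) \<le>
        ennreal (1 * K) * Lnorm q 0 t (\<lambda>w. ennreal (w powr (\<alpha> - a)) * ?g w)"
    proof (rule K(2))
      fix x w :: real assume "0 < w" "w < x" "x < t"
      then show "ennreal (x powr (\<alpha> - a - recip q)) \<le>
          ennreal (1 * w powr (a - \<alpha>) * x powr (- (a - \<alpha>) - recip q)) * ennreal (w powr (\<alpha> - a))"
        by (simp flip: ennreal_mult' powr_add add: mult_ac)
    qed (auto intro!: borel_lebesgue_on)
    also have "Lnorm q 0 t (\<lambda>w. ennreal (w powr (\<alpha> - a)) * ?g w) = Lnorm q 0 t (\<lambda>w. ennreal (w powr (\<alpha> - recip q)) * ?h w)"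
      by (intro Lnorm_cong) (simp flip: mult.assoc ennreal_mult' powr_add)
    finally have "Lnorm q 0 t (\<lambda>u. ennreal (u powr (\<alpha> - recip q)) * H_upper U W f u) \<le>
        ennreal C1 * (ennreal (1 * K) * Lnorm q 0 t (\<lambda>u. ennreal (u powr (\<alpha> - recip q)) * rearr f u))"
      by (simp add: mult_left_mono)
    then show "Lnorm q 0 t (\<lambda>u. ennreal (u powr (\<alpha> - recip q)) * H_upper U W f u) \<le>
        ennreal (C1 * K) * Lnorm q 0 t (\<lambda>u. ennreal (u powr (\<alpha> - recip q)) * rearr f u)"
      using C1(1) by (simp add: ennreal_mult' mult.assoc)
  qed (use C1 K in simp)
  qed
qed

text \<open>Enlarging (0,t) to (0,2t) and substituting back turns the argument \<open>u\<close> into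
  \<open>2 * u\<close>, where the average dominates; the dilation costs only
  \<open>2 powr \<alpha>\<close>.\<close>

lemma H_lower_inner_ge:
  assumes q: "0 < q" and W: "0 < W"
  obtains C :: real where "0 < C"
    "\<And>f t. 0 < t \<Longrightarrow> Lnorm q 0 t (\<lambda>u. ennreal (u powr (\<alpha> - recip q)) * rearr f u) \<le>
      ennreal C * Lnorm q 0 t (\<lambda>u. ennreal (u powr (\<alpha> - recip q)) * H_lower V W f u)"
proof -
  obtain C where C: "0 < C" "\<And>f u. 0 < u \<Longrightarrow> rearr f (2 * u) \<le> ennreal C * H_lower V W f u"
    using rearr_le_H_lower[OF W] by blast
  show thesis
  proof (rule that[of "2 powr \<alpha> * C"])
    fix f and t :: real assume t: "0 < t"
    let ?L = "Lnorm q 0 t (\<lambda>u. ennreal (u powr (\<alpha> - recip q)) * H_lower V W f u)"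
    have "Lnorm q 0 t (\<lambda>u. ennreal (u powr (\<alpha> - recip q)) * rearr f u) \<le>
        Lnorm q 0 (2 * t) (\<lambda>u. ennreal (u powr (\<alpha> - recip q)) * rearr f u)"
      using t by (intro Lnorm_subinterval q) auto
    also have "\<dots> \<le> ennreal (2 powr \<alpha>) * Lnorm q 0 t (\<lambda>u. ennreal (u powr (\<alpha> - recip q)) * rearr f (2 * u))"
      by (intro Lnorm_scale_powr_le q rearr_borel) auto
    also have "\<dots> \<le> ennreal (2 powr \<alpha>) * (ennreal C * ?L)"
      by (intro mult_left_mono Lnorm_weighted_le q C H_lower_measurable W
          measurable_compose[OF _ rearr_borel]) auto
    finally show "Lnorm q 0 t (\<lambda>u. ennreal (u powr (\<alpha> - recip q)) * rearr f u) \<le> ennreal (2 powr \<alpha> * C) * ?L"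
      by (simp add: ennreal_mult' mult.assoc)
  qed (use C in simp)
qed

lemma equiv_onI:
  assumes "0 < C" "0 < D" "\<And>x. x \<in> S \<Longrightarrow> F x \<le> ennreal C * G x" "\<And>x. x \<in> S \<Longrightarrow> G x \<le> ennreal D * F x"
  shows "equiv_on S F G"
  unfolding equiv_on_def
proof (intro exI conjI ballI)
  \<comment> \<open>The maximum only serves the requirement \<open>c \<le> C\<close> in
    \<open>equiv_on\<close>.\<close>
  show "0 < 1 / D" "1 / D \<le> max C (1 / D)" using assms by auto
  fix x assume x: "x \<in> S"
  have "ennreal (1 / D) * G x \<le> ennreal (1 / D) * (ennreal D * F x)"
    by (intro mult_left_mono assms x) auto
  then show "ennreal (1 / D) * G x \<le> F x"
    using assms(2) by (simp flip: mult.assoc ennreal_mult')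
  have "F x \<le> ennreal C * G x" by (intro assms x)
  also have "\<dots> \<le> ennreal (max C (1 / D)) * G x"
    by (intro mult_right_mono ennreal_leI) auto
  finally show "F x \<le> ennreal (max C (1 / D)) * G x" .
qed

lemma H_upper_equiv:
  assumes b: "b \<in> SV01" and q: "0 < q" and r: "0 < r" and W: "0 < W" and less: "recip p < recip U"
  shows "equiv_on M01 (small_Lorentz_norm b p q r) (\<lambda>f. Bnorm b p q r (H_upper U W f))"
proof -
  obtain C where C: "0 < C" "\<And>f u. 0 < u \<Longrightarrow> rearr f u \<le> ennreal C * H_upper U W f u"
    using rearr_le_H_upper[OF W] by blast
  obtain D where D: "0 < D"
    "\<And>f t. Lnorm q 0 t (\<lambda>u. ennreal (u powr (recip p - recip q)) * H_upper U W f u) \<le>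
      ennreal D * Lnorm q 0 t (\<lambda>u. ennreal (u powr (recip p - recip q)) * rearr f u)"
    using H_upper_inner_le[OF q W less] by blast
  show ?thesis
    unfolding small_Lorentz_norm_def
    by (intro equiv_onI[OF C(1) D(1)] Bnorm_le b q r D(2) Lnorm_weighted_le rearr_borel
        H_upper_measurable W C(2))
qed

text \<open>The value \<open>top\<close> for \<open>v \<le> 0\<close> only serves to make \<open>G\<close> monotone on the whole line.\<close>

lemma scaled_inner_antimono:
  fixes \<alpha> :: real
  assumes q: "0 < q" and h: "antimono h"
  defines "G \<equiv> \<lambda>v. if v \<le> 0 then top else
      ennreal (v powr (- \<alpha>)) * Lnorm q 0 v (\<lambda>w. ennreal (w powr (\<alpha> - recip q)) * h w)"
  shows "antimono G"
proof (rule antimonoI)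
  fix u v :: real assume uv: "u \<le> v"
  let ?I = "\<lambda>v. Lnorm q 0 v (\<lambda>w. ennreal (w powr (\<alpha> - recip q)) * h w)"
  have m: "h \<in> borel_measurable borel" by (intro borel_measurable_antimono_ennreal h)
  show "G v \<le> G u"
  proof (cases "0 < u")
    case True
    \<comment> \<open>Since \<open>1 \<le> s\<close>, monotonicity gives
      \<open>h (s * w) \<le> h w\<close>, and the factor \<open>s powr \<alpha>\<close> from the
      dilation turns \<open>v powr (- \<alpha>)\<close> into
      \<open>u powr (- \<alpha>)\<close>.\<close>
    define s where "s = v / u"
    have s: "1 \<le> s" "v = s * u" "0 < s" using True uv by (auto simp: s_def)
    have "?I v \<le> ennreal (s powr \<alpha>) * Lnorm q 0 u (\<lambda>w. ennreal (w powr (\<alpha> - recip q)) * h (s * w))"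
      unfolding s(2) by (intro Lnorm_scale_powr_le q s m)
    also have "\<dots> \<le> ennreal (s powr \<alpha>) * (1 * ?I u)"
      using h s by (intro mult_left_mono Lnorm_weighted_le q m measurable_compose[OF _ m])
        (auto simp: antimono_def mult_le_cancel_right1)
    finally have "ennreal (v powr (- \<alpha>)) * ?I v \<le> ennreal (v powr (- \<alpha>)) * (ennreal (s powr \<alpha>) * (1 * ?I u))"
      by (rule mult_left_mono) simp
    also have "\<dots> = ennreal (u powr (- \<alpha>)) * ?I u"
      using s True by (simp add: powr_mult mult_ac flip: mult.assoc ennreal_mult' powr_add)
    finally show ?thesis using True uv by (simp add: G_def)
  qed (simp add: G_def)
qed

text \<open>The average over (u,1) is cut at \<open>t\<close>. The part over (u,t) is a Hardy
  inequality inside (0,t); the part over (t,1) does not depend on \<open>u\<close> and survives as a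
  tail, which only the outer norm can absorb. The powers \<open>a\<close> and \<open>a'\<close>
  belong to the trades of \<open>W\<close> for \<open>q\<close> and of \<open>q\<close> for
  \<open>r\<close>.\<close>

lemma H_lower_inner_le:
  assumes q: "0 < q" and r: "0 < r" and W: "0 < W" and a: "recip V < a" "a < a'" "a' < \<alpha>"
  obtains C :: real where "0 < C"
    "\<And>f t G. 0 < t \<Longrightarrow> t < 1 \<Longrightarrow>
      G = (\<lambda>v. if v \<le> 0 then top else ennreal (v powr (- \<alpha>)) * Lnorm q 0 v (\<lambda>w. ennreal (w powr (\<alpha> - recip q)) * rearr f w)) \<Longrightarrow>
      Lnorm q 0 t (\<lambda>u. ennreal (u powr (\<alpha> - recip q)) * H_lower V W f u) \<le>
      ennreal C * (Lnorm q 0 t (\<lambda>u. ennreal (u powr (\<alpha> - recip q)) * rearr f u) +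
        ennreal (t powr (\<alpha> - a')) * Lnorm r t 1 (\<lambda>w. ennreal (w powr (a' - recip r)) * G w))"
proof -
  have "0 \<le> recip V" by simp
  then have a0: "0 \<le> a" "0 \<le> a'" using a by linarith+
  have pos: "0 < \<alpha> - a" using a by simp
  obtain C1 where C1: "0 < C1"
    "\<And>h u T. antimono h \<Longrightarrow> 0 < u \<Longrightarrow>
      Lnorm W u T (\<lambda>v. ennreal (v powr (recip V - recip W)) * h v) \<le>
      ennreal (C1 * u powr (recip V - a)) * (ennreal (u powr a) * h u + Lnorm q u T (\<lambda>w. ennreal (w powr (a - recip q)) * h w))"
    using lower_average_le[OF q W a(1) a0(1)] by blast
  obtain C2 where C2: "0 < C2"
    "\<And>h u T. antimono h \<Longrightarrow> 0 < u \<Longrightarrow>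
      Lnorm q u T (\<lambda>v. ennreal (v powr (a - recip q)) * h v) \<le>
      ennreal (C2 * u powr (a - a')) * (ennreal (u powr a') * h u + Lnorm r u T (\<lambda>w. ennreal (w powr (a' - recip r)) * h w))"
    using lower_average_le[OF r q a(2) a0(2)] by blast
  obtain C4 where C4: "0 < C4"
    "\<And>a b f g. f \<in> borel_measurable (lebesgue_on {a<..<b}) \<Longrightarrow> g \<in> borel_measurable (lebesgue_on {a<..<b})
      \<Longrightarrow> Lnorm q a b (\<lambda>x. f x + g x) \<le> ennreal C4 * (Lnorm q a b f + Lnorm q a b g)"
    using Lnorm_add_le[OF q] by blast
  obtain C5 where C5: "0 < C5"
    "\<And>a b c g. g \<in> borel_measurable (lebesgue_on {a<..<b})
      \<Longrightarrow> Lnorm q a b g \<le> ennreal C5 * (Lnorm q a c g + Lnorm q c b g)"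
    using Lnorm_split_le[OF q] by blast
  obtain C6 where C6: "0 < C6"
    "\<And>u. 0 < u \<Longrightarrow> Lnorm q 0 u (\<lambda>w. ennreal (w powr ((\<alpha> - a) - recip q))) \<le> ennreal (C6 * u powr (\<alpha> - a))"
    using Lnorm_powr_lower[OF q pos] by blast
  obtain C7 where C7: "0 < C7"
    "\<And>h v. antimono h \<Longrightarrow> 0 < v \<Longrightarrow> ennreal (v powr \<alpha>) * h v \<le>
      ennreal C7 * Lnorm q (v / 2) v (\<lambda>w. ennreal (w powr (\<alpha> - recip q)) * h w)"
    using antimono_le_Lnorm[OF q] by blast
  define C1' where "C1' = C1 * max 1 C5"
  define C9 where "C9 = C6 * C7 * C2"
  have C9: "0 < C9" "0 < C1'" using C1 C2 C6 C7 by (auto simp: C9_def C1'_def)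
  show thesis
  proof (rule hardy_right[OF q pos], goal_cases)
    case K: (1 K)
    define D where "D = C1' * (C4 * (1 + C4 * (K + C9)))"
    have D: "0 < D" unfolding D_def using C9 C4 K(1) by (intro mult_pos_pos add_pos_pos) auto
    have D': "ennreal D = ennreal C1' * (ennreal C4 * (1 + ennreal C4 * (ennreal K + ennreal C9)))"
      using C9 C4 K by (simp add: D_def ennreal_mult ennreal_plus)
    show thesis
    proof (rule that[OF D])
      fix f and t :: real and G :: "real \<Rightarrow> ennreal"
      assume t: "0 < t" "t < 1"
      assume G: "G = (\<lambda>v. if v \<le> 0 then top else ennreal (v powr (- \<alpha>)) * Lnorm q 0 v (\<lambda>w. ennreal (w powr (\<alpha> - recip q)) * rearr f w))"
      let ?h = "rearr f"
      note [measurable] = rearr_borel[of f]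
      let ?g = "\<lambda>w. ennreal (w powr (a - recip q)) * ?h w"
      let ?I = "\<lambda>t. Lnorm q 0 t (\<lambda>u. ennreal (u powr (\<alpha> - recip q)) * ?h u)"
      let ?R = "Lnorm r t 1 (\<lambda>w. ennreal (w powr (a' - recip r)) * G w)"
      let ?M = "Lnorm q t 1 ?g"
      let ?S = "?I t + ennreal (t powr (\<alpha> - a')) * ?R"
      \<comment> \<open>Contributions of the value at \<open>u\<close>, of the range (u,t) and of
        the range (t,1); in the last one \<open>?M\<close> is constant in \<open>u\<close>, so a
        pure power remains.\<close>
      let ?X = "\<lambda>u. ennreal (u powr (\<alpha> - recip q)) * ?h u"
      let ?Y = "\<lambda>u. ennreal (u powr (\<alpha> - a - recip q)) * Lnorm q u t ?g"
      let ?Z = "\<lambda>u. ?M * ennreal (u powr (\<alpha> - a - recip q))"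
      have Gm: "antimono G"
        unfolding G by (intro scaled_inner_antimono q rearr_antimono)
      have Gb: "G \<in> borel_measurable borel"
        by (intro borel_measurable_antimono_ennreal Gm)
      have hG: "?h w \<le> ennreal C7 * G w" if w: "0 < w" for w
      proof -
        have "ennreal (w powr \<alpha>) * ?h w \<le> ennreal C7 * Lnorm q (w / 2) w ?X"
          using w by (intro C7 rearr_antimono)
        also have "\<dots> \<le> ennreal C7 * ?I w"
          using w by (intro mult_left_mono Lnorm_subinterval q) auto
        finally have "ennreal (w powr 0) * ?h w \<le> (ennreal C7 * ?I w) * ennreal (w powr (- \<alpha>))"
          using w by (rule powr_shift_le) simp
        then show ?thesis using w by (simp add: G mult_ac)
      qed
      have gm: "?g \<in> borel_measurable (lebesgue_on S)" for S
        by (intro powr_mult_measurable borel_lebesgue_on rearr_borel)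
      have Xm: "?X \<in> borel_measurable (lebesgue_on S)" for S
        by (intro powr_mult_measurable borel_lebesgue_on rearr_borel)
      have Ym: "?Y \<in> borel_measurable (lebesgue_on S)" for S
        by (intro powr_mult_measurable borel_lebesgue_on Lnorm_right_measurable q)
      have Zm: "?Z \<in> borel_measurable (lebesgue_on S)" for S
        by (intro borel_measurable_times_ennreal powr_Lnorm_measurable) auto
      have "Lnorm q 0 t (\<lambda>u. ennreal (u powr (\<alpha> - recip q)) * H_lower V W f u) \<le>
          Lnorm q 0 t (\<lambda>u. ennreal C1' * (?X u + (?Y u + ?Z u)))"
      proof (intro Lnorm_mono q powr_mult_measurable borel_lebesgue_on H_lower_measurable W)
        fix u assume u: "0 < u" "u < t"
        let ?N = "Lnorm q u t ?g + ?M"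
        have "ennreal (u powr (\<alpha> - recip q)) * H_lower V W f u \<le> ennreal (u powr (\<alpha> - recip q)) *
            (ennreal (u powr (- recip V)) * (ennreal (C1 * u powr (recip V - a)) * (ennreal (u powr a) * ?h u + Lnorm q u 1 ?g)))"
          unfolding H_lower_def using u by (intro mult_left_mono C1 rearr_antimono) auto
        also have "\<dots> = (ennreal (u powr (\<alpha> - recip q) * (u powr (- recip V) * u powr (recip V - a))) * ennreal C1) * (ennreal (u powr a) * ?h u + Lnorm q u 1 ?g)"
          using C1 by (simp add: ennreal_mult' mult_ac)
        also have "u powr (\<alpha> - recip q) * (u powr (- recip V) * u powr (recip V - a)) = u powr (\<alpha> - a - recip q)"
          using u by (simp add: algebra_simps flip: powr_add)
        also have "ennreal (u powr a) * ?h u + Lnorm q u 1 ?g \<le> ennreal (max 1 C5) * (ennreal (u powr a) * ?h u + ?N)"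
        proof -
          have "Lnorm q u 1 ?g \<le> ennreal C5 * ?N" by (intro C5 gm)
          also have "\<dots> \<le> ennreal (max 1 C5) * ?N" by (intro mult_right_mono ennreal_leI) auto
          finally have "Lnorm q u 1 ?g \<le> ennreal (max 1 C5) * ?N" .
          moreover have "1 * (ennreal (u powr a) * ?h u) \<le> ennreal (max 1 C5) * (ennreal (u powr a) * ?h u)"
            by (intro mult_right_mono) (auto simp flip: ennreal_1 intro!: ennreal_leI)
          ultimately show ?thesis by (simp add: distrib_left add_mono)
        qed
        finally have "ennreal (u powr (\<alpha> - recip q)) * H_lower V W f u \<le>
            (ennreal (u powr (\<alpha> - a - recip q)) * ennreal C1) * (ennreal (max 1 C5) * (ennreal (u powr a) * ?h u + ?N))"
          by (simp add: mult_left_mono)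
        also have "\<dots> = ennreal C1' * (ennreal (u powr (\<alpha> - a - recip q)) * (ennreal (u powr a) * ?h u) + (?Y u + ?Z u))"
          using C1 by (simp add: C1'_def ennreal_mult' algebra_simps)
        also have "ennreal (u powr (\<alpha> - a - recip q)) * (ennreal (u powr a) * ?h u) = ?X u"
          using u by (simp flip: mult.assoc ennreal_mult' powr_add)
        finally show "ennreal (u powr (\<alpha> - recip q)) * H_lower V W f u \<le> ennreal C1' * (?X u + (?Y u + ?Z u))" .
      qed
      also have "\<dots> = ennreal C1' * Lnorm q 0 t (\<lambda>u. ?X u + (?Y u + ?Z u))"
        by (intro Lnorm_cmult q borel_measurable_add Xm Ym Zm)
      also have "\<dots> \<le> ennreal C1' * (ennreal C4 * (Lnorm q 0 t ?X + Lnorm q 0 t (\<lambda>u. ?Y u + ?Z u)))"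
        by (intro mult_left_mono C4 borel_measurable_add Xm Ym Zm) auto
      also have "\<dots> \<le> ennreal C1' * (ennreal C4 * (?S + ennreal C4 * (ennreal K * ?S + ennreal C9 * ?S)))"
      proof (intro mult_left_mono add_mono)
        show "Lnorm q 0 t ?X \<le> ?S" by simp
        have "Lnorm q 0 t ?Y \<le> ennreal (1 * K) * Lnorm q 0 t (\<lambda>w. ennreal (w powr (\<alpha> - a)) * ?g w)"
        proof (rule K(2))
          fix x w :: real assume "0 < x" "x < w" "w < t"
          then show "ennreal (x powr (\<alpha> - a - recip q)) \<le>
              ennreal (1 * w powr (- (\<alpha> - a)) * x powr ((\<alpha> - a) - recip q)) * ennreal (w powr (\<alpha> - a))"
            by (simp add: mult_ac flip: ennreal_mult' mult.assoc powr_add)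
        qed (auto intro!: borel_lebesgue_on)
        also have "Lnorm q 0 t (\<lambda>w. ennreal (w powr (\<alpha> - a)) * ?g w) = ?I t"
          by (intro Lnorm_cong) (simp flip: mult.assoc ennreal_mult' powr_add)
        also have "ennreal (1 * K) * ?I t \<le> ennreal K * ?S"
          by (intro mult_mono) auto
        finally have Y: "Lnorm q 0 t ?Y \<le> ennreal K * ?S" .
        \<comment> \<open>Replacing \<open>h\<close> by the larger \<open>G\<close> before the trade
          of \<open>q\<close> for \<open>r\<close> makes the tail consist of inner norms, on which
          the outer norm acts.\<close>
        have "?M \<le> ennreal C7 * Lnorm q t 1 (\<lambda>w. ennreal (w powr (a - recip q)) * G w)"
          using t by (intro Lnorm_weighted_le q rearr_borel Gb hG) auto
        also have "\<dots> \<le> ennreal C7 * (ennreal (C2 * t powr (a - a')) * (ennreal (t powr a') * G t + ?R))"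
          using t by (intro mult_left_mono C2 Gm) auto
        finally have M: "?M \<le> ennreal C7 * (ennreal (C2 * t powr (a - a')) * (ennreal (t powr a') * G t + ?R))" .
        have "Lnorm q 0 t ?Z = ?M * Lnorm q 0 t (\<lambda>u. ennreal (u powr (\<alpha> - a - recip q)))"
          by (intro Lnorm_cmult q powr_Lnorm_measurable)
        also have "\<dots> \<le> (ennreal C7 * (ennreal (C2 * t powr (a - a')) * (ennreal (t powr a') * G t + ?R)))
            * ennreal (C6 * t powr (\<alpha> - a))"
          using t by (intro mult_mono M C6) auto
        also have "\<dots> = ennreal C9 * (ennreal (t powr (\<alpha> - a) * t powr (a - a')) * (ennreal (t powr a') * G t + ?R))"
          using C2 C6 C7 by (simp add: C9_def ennreal_mult' mult_ac)
        also have "t powr (\<alpha> - a) * t powr (a - a') = t powr (\<alpha> - a')"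
          using t by (simp flip: powr_add)
        \<comment> \<open>The boundary term is again an inner norm: the powers combine to
          \<open>t powr \<alpha> * G t\<close>, which is \<open>?I t\<close>.\<close>
        also have "ennreal (t powr (\<alpha> - a')) * (ennreal (t powr a') * G t + ?R) = ?S"
          using t by (simp add: G distrib_left flip: mult.assoc ennreal_mult' powr_add)
        finally have Z: "Lnorm q 0 t ?Z \<le> ennreal C9 * ?S" .
        have "Lnorm q 0 t (\<lambda>u. ?Y u + ?Z u) \<le> ennreal C4 * (Lnorm q 0 t ?Y + Lnorm q 0 t ?Z)"
          by (intro C4 Ym Zm)
        also have "\<dots> \<le> ennreal C4 * (ennreal K * ?S + ennreal C9 * ?S)"
          by (intro mult_left_mono add_mono Y Z) simp
        finally show "Lnorm q 0 t (\<lambda>u. ?Y u + ?Z u) \<le> ennreal C4 * (ennreal K * ?S + ennreal C9 * ?S)" .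
      qed auto
      also have "\<dots> = ennreal D * ?S"
        unfolding D' by (simp only: distrib_right distrib_left mult.assoc mult_1_left add_ac)
      finally show "Lnorm q 0 t (\<lambda>u. ennreal (u powr (\<alpha> - recip q)) * H_lower V W f u) \<le> ennreal D * ?S" .
    qed
  qed
qed

text \<open>The tail left by the inner estimate is a norm over (t,1) with the outer exponent
  \<open>r\<close>, so \<open>hardy_right\<close> applies to it with a weight containing
  \<open>b\<close>.\<close>

lemma H_lower_norm_le:
  assumes b: "b \<in> SV01" and q: "0 < q" and r: "0 < r" and W: "0 < W" and less: "recip V < recip p"
  obtains C :: real where "0 < C"
    "\<And>f. Bnorm b p q r (H_lower V W f) \<le> ennreal C * Bnorm b p q r (rearr f)"
proof -
  let ?\<alpha> = "recip p"
  define a where "a = recip V + (?\<alpha> - recip V) / 3"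
  define a' where "a' = recip V + 2 * (?\<alpha> - recip V) / 3"
  have a: "recip V < a" "a < a'" "a' < ?\<alpha>" using less by (auto simp: a_def a'_def field_simps)
  \<comment> \<open>Half of the gap compares \<open>b x\<close> with \<open>b w\<close> by slow
    variation; the other half is the gap of the Hardy inequality.\<close>
  define \<epsilon> where "\<epsilon> = (?\<alpha> - a') / 2"
  have \<epsilon>: "0 < \<epsilon>" "?\<alpha> - a' = 2 * \<epsilon>" using a by (auto simp: \<epsilon>_def)
  obtain D where D: "0 < D"
    "\<And>f t G. 0 < t \<Longrightarrow> t < 1 \<Longrightarrow>
      G = (\<lambda>v. if v \<le> 0 then top else ennreal (v powr (- ?\<alpha>)) * Lnorm q 0 v (\<lambda>w. ennreal (w powr (?\<alpha> - recip q)) * rearr f w)) \<Longrightarrow>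
      Lnorm q 0 t (\<lambda>u. ennreal (u powr (?\<alpha> - recip q)) * H_lower V W f u) \<le>
      ennreal D * (Lnorm q 0 t (\<lambda>u. ennreal (u powr (?\<alpha> - recip q)) * rearr f u) +
        ennreal (t powr (?\<alpha> - a')) * Lnorm r t 1 (\<lambda>w. ennreal (w powr (a' - recip r)) * G w))"
    using H_lower_inner_le[OF q r W a] by blast
  obtain C4 where C4: "0 < C4"
    "\<And>a b f g. f \<in> borel_measurable (lebesgue_on {a<..<b}) \<Longrightarrow> g \<in> borel_measurable (lebesgue_on {a<..<b})
      \<Longrightarrow> Lnorm r a b (\<lambda>x. f x + g x) \<le> ennreal C4 * (Lnorm r a b f + Lnorm r a b g)"
    using Lnorm_add_le[OF r] by blast
  obtain Cs where Cs: "0 < Cs"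
    "\<And>x w. 0 < x \<Longrightarrow> x \<le> w \<Longrightarrow> w < 1 \<Longrightarrow> x powr \<epsilon> * b x \<le> Cs * (w powr \<epsilon> * b w)"
    using SV01_mono[OF b \<epsilon>(1)] by blast
  show thesis
  proof (rule hardy_right[OF r \<epsilon>(1)], goal_cases)
    case K: (1 K)
    define E where "E = D * (C4 * (1 + Cs * K))"
    have E: "0 < E" unfolding E_def using D C4 Cs K(1) by (intro mult_pos_pos add_pos_pos) auto
    have E': "ennreal E = ennreal D * (ennreal C4 * (1 + ennreal (Cs * K)))"
      using D C4 Cs K by (simp add: E_def ennreal_mult ennreal_plus)
    show thesis
    proof (rule that[OF E])
      fix f
      define G where "G = (\<lambda>v. if v \<le> 0 then top else ennreal (v powr (- ?\<alpha>)) * Lnorm q 0 v (\<lambda>w. ennreal (w powr (?\<alpha> - recip q)) * rearr f w))"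
      let ?I = "\<lambda>t. Lnorm q 0 t (\<lambda>u. ennreal (u powr (?\<alpha> - recip q)) * rearr f u)"
      let ?g = "\<lambda>w. ennreal (w powr (a' - recip r)) * G w"
      let ?R = "\<lambda>t. Lnorm r t 1 ?g"
      let ?\<beta> = "\<lambda>t. ennreal (t powr (- recip r) * b t)"
      let ?A = "\<lambda>t. t powr (?\<alpha> - a' - recip r) * b t"
      let ?Y = "\<lambda>t. ennreal (?A t) * ?R t"
      have Gb: "G \<in> borel_measurable borel"
        unfolding G_def by (intro borel_measurable_antimono_ennreal scaled_inner_antimono q rearr_antimono)
      have Xm: "(\<lambda>t. ?\<beta> t * ?I t) \<in> borel_measurable (lebesgue_on {0<..<1})"
        by (intro SV01_weight_measurable b Lnorm_left_measurable q)
      have Ym: "?Y \<in> borel_measurable (lebesgue_on {0<..<1})"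
        by (intro SV01_weight_measurable b Lnorm_right_measurable r)
      have "Bnorm b p q r (H_lower V W f) \<le> Lnorm r 0 1 (\<lambda>t. ennreal D * (?\<beta> t * ?I t + ?Y t))"
        unfolding Bnorm_def
      proof (intro Lnorm_mono r SV01_weight_measurable b Lnorm_left_measurable q)
        fix t :: real assume t: "0 < t" "t < 1"
        have "?\<beta> t * Lnorm q 0 t (\<lambda>u. ennreal (u powr (?\<alpha> - recip q)) * H_lower V W f u) \<le>
            ?\<beta> t * (ennreal D * (?I t + ennreal (t powr (?\<alpha> - a')) * ?R t))"
          using t by (intro mult_left_mono D G_def) auto
        also have "\<dots> = ennreal D * (?\<beta> t * ?I t + (?\<beta> t * ennreal (t powr (?\<alpha> - a'))) * ?R t)"
          by (simp add: algebra_simps)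
        also have "?\<beta> t * ennreal (t powr (?\<alpha> - a')) = ennreal (t powr (- recip r) * t powr (?\<alpha> - a') * b t)"
          using SV01_pos[OF b t] by (simp add: mult_ac flip: ennreal_mult)
        also have "t powr (- recip r) * t powr (?\<alpha> - a') = t powr (?\<alpha> - a' - recip r)"
          using t by (simp flip: powr_add)
        finally show "?\<beta> t * Lnorm q 0 t (\<lambda>u. ennreal (u powr (?\<alpha> - recip q)) * H_lower V W f u) \<le>
          ennreal D * (?\<beta> t * ?I t + ?Y t)" .
      qed
      also have "\<dots> = ennreal D * Lnorm r 0 1 (\<lambda>t. ?\<beta> t * ?I t + ?Y t)"
        by (intro Lnorm_cmult r borel_measurable_add Xm Ym)
      also have "\<dots> \<le> ennreal D * (ennreal C4 * (Lnorm r 0 1 (\<lambda>t. ?\<beta> t * ?I t) + Lnorm r 0 1 ?Y))"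
        by (intro mult_left_mono C4 Xm Ym) simp
      also have "Lnorm r 0 1 (\<lambda>t. ?\<beta> t * ?I t) = Bnorm b p q r (rearr f)"
        by (simp add: Bnorm_def)
      also have "Lnorm r 0 1 ?Y \<le> ennreal (Cs * K) * Lnorm r 0 1 (\<lambda>w. ennreal (w powr (?\<alpha> - a') * b w) * ?g w)"
      proof (rule K(2))
        show "?A \<in> borel_measurable (lebesgue_on {0<..<1})"
          by (intro SV01_measurable b)
        show "(\<lambda>w. ennreal (w powr (?\<alpha> - a') * b w)) \<in> borel_measurable (lebesgue_on {0<..<1})"
          by (intro measurable_compose[OF SV01_measurable] measurable_ennreal b)
        show "?g \<in> borel_measurable (lebesgue_on {0<..<1})"
          by (intro powr_mult_measurable borel_lebesgue_on Gb)
        fix x w :: real assume xw: "0 < x" "x < w" "w < 1"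
        have "x powr (\<epsilon> - recip r) * (x powr \<epsilon> * b x) \<le> x powr (\<epsilon> - recip r) * (Cs * (w powr \<epsilon> * b w))"
          using xw by (intro mult_left_mono Cs) auto
        moreover have "x powr (?\<alpha> - a' - recip r) = x powr (\<epsilon> - recip r) * x powr \<epsilon>"
          unfolding \<epsilon>(2) using xw by (simp flip: powr_add)
        moreover have "w powr \<epsilon> = w powr (- \<epsilon>) * w powr (?\<alpha> - a')"
          unfolding \<epsilon>(2) using xw by (simp flip: powr_add)
        ultimately have "?A x \<le> (Cs * w powr (- \<epsilon>) * x powr (\<epsilon> - recip r)) * (w powr (?\<alpha> - a') * b w)"
          by (simp add: mult_ac)
        then have "ennreal (?A x) \<le> ennreal ((Cs * w powr (- \<epsilon>) * x powr (\<epsilon> - recip r)) * (w powr (?\<alpha> - a') * b w))"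
          by (rule ennreal_leI)
        also have "\<dots> = ennreal (Cs * w powr (- \<epsilon>) * x powr (\<epsilon> - recip r)) * ennreal (w powr (?\<alpha> - a') * b w)"
          using Cs by (intro ennreal_mult') auto
        finally show "ennreal (?A x) \<le> ennreal (Cs * w powr (- \<epsilon>) * x powr (\<epsilon> - recip r)) * ennreal (w powr (?\<alpha> - a') * b w)" .
      qed (use Cs in simp)
      \<comment> \<open>\<open>G\<close> carries the power \<open>w powr (- recip p)\<close>, which
        cancels the intermediate powers and leaves exactly the integrand of
        \<open>Bnorm\<close>.\<close>
      also have "Lnorm r 0 1 (\<lambda>w. ennreal (w powr (?\<alpha> - a') * b w) * ?g w) = Bnorm b p q r (rearr f)"
        unfolding Bnorm_def
      proof (intro Lnorm_cong)
        fix w :: real assume w: "0 < w" "w < 1"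
        have "ennreal (w powr (?\<alpha> - a') * b w) * ?g w =
            ennreal (w powr (?\<alpha> - a') * b w * (w powr (a' - recip r) * w powr (- ?\<alpha>))) * ?I w"
          using w SV01_pos[OF b w] by (simp add: G_def ennreal_mult mult.assoc)
        also have "w powr (?\<alpha> - a') * b w * (w powr (a' - recip r) * w powr (- ?\<alpha>)) = w powr (- recip r) * b w"
          using w by (simp add: mult_ac flip: powr_add mult.assoc)
        finally show "ennreal (w powr (?\<alpha> - a') * b w) * ?g w = ?\<beta> w * ?I w" .
      qed
      finally have "Bnorm b p q r (H_lower V W f) \<le> ennreal D * (ennreal C4 *
          (Bnorm b p q r (rearr f) + ennreal (Cs * K) * Bnorm b p q r (rearr f)))"
        by (simp add: mult_left_mono add_left_mono)
      then show "Bnorm b p q r (H_lower V W f) \<le> ennreal E * Bnorm b p q r (rearr f)"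
        unfolding E' by (simp only: distrib_right distrib_left mult.assoc mult_1_left)
    qed
  qed
qed

lemma H_lower_equiv:
  assumes b: "b \<in> SV01" and q: "0 < q" and r: "0 < r" and W: "0 < W" and less: "recip V < recip p"
  shows "equiv_on M01 (small_Lorentz_norm b p q r) (\<lambda>f. Bnorm b p q r (H_lower V W f))"
proof -
  obtain C where C: "0 < C"
    "\<And>f t. 0 < t \<Longrightarrow> Lnorm q 0 t (\<lambda>u. ennreal (u powr (recip p - recip q)) * rearr f u) \<le>
      ennreal C * Lnorm q 0 t (\<lambda>u. ennreal (u powr (recip p - recip q)) * H_lower V W f u)"
    using H_lower_inner_ge[OF q W] by blast
  obtain D where D: "0 < D" "\<And>f. Bnorm b p q r (H_lower V W f) \<le> ennreal D * Bnorm b p q r (rearr f)"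
    using H_lower_norm_le[OF b q r W less] by blast
  show ?thesis
    unfolding small_Lorentz_norm_def
    by (intro equiv_onI[OF C(1) D(1)] Bnorm_le b q r D(2) C(2))
qed

section \<open>Sharpness\<close>

text \<open>Almost monotonicity of \<open>t powr \<eta> * b t\<close> bounds it up to 1/2 by its
  value there. Near 1 no such comparison point exists, and the almost decreasing
  \<open>t powr (- \<eta>) * b t\<close> takes over.\<close>

lemma SV01_bounded:
  assumes b: "b \<in> SV01" and "0 < \<eta>"
  obtains D :: real where "0 < D" "\<And>t. 0 < t \<Longrightarrow> t < 1 \<Longrightarrow> t powr \<eta> * b t \<le> D"
proof -
  obtain C where C: "0 < C"
    "\<And>x w. 0 < x \<Longrightarrow> x \<le> w \<Longrightarrow> w < 1 \<Longrightarrow> x powr \<eta> * b x \<le> C * (w powr \<eta> * b w)"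
    using SV01_mono[OF assms] by blast
  obtain C' where C': "0 < C'"
    "\<And>x w. 0 < x \<Longrightarrow> x \<le> w \<Longrightarrow> w < 1 \<Longrightarrow> w powr (- \<eta>) * b w \<le> C' * (x powr (- \<eta>) * b x)"
    using SV01_antimono[OF assms] by blast
  let ?X = "C * ((1/2) powr \<eta> * b (1/2))" and ?Y = "C' * ((1/2) powr (- \<eta>) * b (1/2))"
  have "0 < b (1/2)" by (rule SV01_pos[OF b]) auto
  then have pos: "0 < ?X" "0 < ?Y" using C C' by auto
  show thesis
  proof (rule that[of "?X + ?Y"])
    show "0 < ?X + ?Y" using pos by simp
    fix t :: real assume t: "0 < t" "t < 1"
    show "t powr \<eta> * b t \<le> ?X + ?Y"
    proof (cases "t \<le> 1/2")
      case True
      with C(2)[of t "1/2"] t pos show ?thesis by simp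
    next
      case False
      have "t powr \<eta> \<le> 1" "1 \<le> t powr (- \<eta>)"
        using t \<open>0 < \<eta>\<close> powr_mono2[of \<eta> t 1] powr_mono2'[of "- \<eta>" t 1] by auto
      then have "t powr \<eta> * b t \<le> t powr (- \<eta>) * b t"
        using SV01_pos[OF b t] by (intro mult_right_mono) auto
      also have "\<dots> \<le> ?Y" using False t by (intro C') auto
      finally show ?thesis using pos by simp
    qed
  qed
qed

text \<open>The inner norm is of order \<open>t powr (recip p - s)\<close>. Half of this positive
  power absorbs \<open>b\<close>, the other half makes the outer norm converge at 0. The case
  \<open>s = 0\<close> is the constant function.\<close>

lemma small_Lorentz_norm_powr_finite:
  assumes b: "b \<in> SV01" and q: "0 < q" and r: "0 < r" and s: "0 \<le> s" "s < recip p"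
  shows "small_Lorentz_norm b p q r (\<lambda>x. complex_of_real (x powr (- s))) < top"
proof -
  let ?f = "\<lambda>x. complex_of_real (x powr (- s))"
  let ?I = "\<lambda>t. Lnorm q 0 t (\<lambda>u. ennreal (u powr (recip p - recip q)) * rearr ?f u)"
  let ?\<beta> = "\<lambda>t. ennreal (t powr (- recip r) * b t)"
  define \<epsilon> where "\<epsilon> = (recip p - s) / 2"
  have \<epsilon>: "0 < \<epsilon>" "recip p - s = 2 * \<epsilon>" using s by (auto simp: \<epsilon>_def)
  have "0 < 2 * \<epsilon>" using \<epsilon> by simp
  from Lnorm_powr_lower[OF q this] obtain C1 where C1: "0 < C1"
    "\<And>u. 0 < u \<Longrightarrow> Lnorm q 0 u (\<lambda>w. ennreal (w powr (2 * \<epsilon> - recip q))) \<le> ennreal (C1 * u powr (2 * \<epsilon>))"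
    by blast
  obtain C2 where C2: "0 < C2"
    "\<And>u. 0 < u \<Longrightarrow> Lnorm r 0 u (\<lambda>w. ennreal (w powr (\<epsilon> - recip r))) \<le> ennreal (C2 * u powr \<epsilon>)"
    using Lnorm_powr_lower[OF r \<epsilon>(1)] by blast
  obtain D where D: "0 < D" "\<And>t. 0 < t \<Longrightarrow> t < 1 \<Longrightarrow> t powr \<epsilon> * b t \<le> D"
    using SV01_bounded[OF b \<epsilon>(1)] by blast
  have "small_Lorentz_norm b p q r ?f \<le> Lnorm r 0 1 (\<lambda>t. ennreal (C1 * D) * ennreal (t powr (\<epsilon> - recip r)))"
    unfolding small_Lorentz_norm_def Bnorm_def
  proof (intro Lnorm_mono r SV01_weight_measurable b Lnorm_left_measurable q)
    fix t :: real assume t: "0 < t" "t < 1"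
    have "?I t = Lnorm q 0 t (\<lambda>w. ennreal (w powr (2 * \<epsilon> - recip q)))"
      unfolding \<epsilon>(2)[symmetric] using t s
      by (intro Lnorm_cong) (simp add: rearr_powr algebra_simps flip: ennreal_mult' powr_add)
    also have "\<dots> \<le> ennreal (C1 * t powr (2 * \<epsilon>))" by (intro C1 t)
    finally have "?\<beta> t * ?I t \<le> ?\<beta> t * ennreal (C1 * t powr (2 * \<epsilon>))"
      by (rule mult_left_mono) simp
    also have "\<dots> = ennreal (t powr (- recip r) * b t * (C1 * t powr (2 * \<epsilon>)))"
      using C1 by (intro ennreal_mult''[symmetric]) simp
    also have "t powr (- recip r) * b t * (C1 * t powr (2 * \<epsilon>)) = C1 * (t powr (2 * \<epsilon>) * t powr (- recip r)) * b t"
      by simp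
    also have "t powr (2 * \<epsilon>) * t powr (- recip r) = t powr (\<epsilon> - recip r) * t powr \<epsilon>"
      using t by (simp flip: powr_add)
    also have "C1 * (t powr (\<epsilon> - recip r) * t powr \<epsilon>) * b t = C1 * t powr (\<epsilon> - recip r) * (t powr \<epsilon> * b t)"
      by simp
    also have "ennreal \<dots> \<le> ennreal (C1 * t powr (\<epsilon> - recip r) * D)"
      using C1 t by (intro ennreal_leI mult_left_mono D) auto
    also have "\<dots> = ennreal (C1 * D) * ennreal (t powr (\<epsilon> - recip r))"
      using C1 D by (simp add: mult_ac flip: ennreal_mult')
    finally show "?\<beta> t * ?I t \<le> ennreal (C1 * D) * ennreal (t powr (\<epsilon> - recip r))" .
  qed
  also have "\<dots> = ennreal (C1 * D) * Lnorm r 0 1 (\<lambda>t. ennreal (t powr (\<epsilon> - recip r)))"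
    by (intro Lnorm_cmult r powr_Lnorm_measurable)
  also have "\<dots> \<le> ennreal (C1 * D) * ennreal (C2 * 1 powr \<epsilon>)"
    by (intro mult_left_mono C2) auto
  also have "\<dots> < top" by (simp add: ennreal_mult_less_top)
  finally show ?thesis .
qed

text \<open>Positivity excludes that multiplying the norm by an eigenvalue changes nothing. It
  suffices to bound the outer integrand from below on (1/4,1/2).\<close>

lemma small_Lorentz_norm_powr_pos:
  assumes b: "b \<in> SV01" and q: "0 < q" and r: "0 < r" and s: "0 \<le> s"
  shows "0 < small_Lorentz_norm b p q r (\<lambda>x. complex_of_real (x powr (- s)))"
proof -
  let ?f = "\<lambda>x. complex_of_real (x powr (- s))"
  let ?I = "\<lambda>t. Lnorm q 0 t (\<lambda>u. ennreal (u powr (recip p - recip q)) * rearr ?f u)"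
  let ?\<beta> = "\<lambda>t. ennreal (t powr (- recip r) * b t)"
  obtain c where c: "0 < c"
    "\<And>v. 0 < v \<Longrightarrow> ennreal (c * v powr recip p) \<le> Lnorm q (v / 2) v (\<lambda>w. ennreal (w powr (recip p - recip q)))"
    using Lnorm_powr_dyadic[OF q] by blast
  obtain C where C: "0 < C"
    "\<And>x w. 0 < x \<Longrightarrow> x \<le> w \<Longrightarrow> w < 1 \<Longrightarrow> w powr (- 1) * b w \<le> C * (x powr (- 1) * b x)"
    using SV01_antimono[OF b, of 1] by auto
  have b2: "0 < b (1/2)" by (rule SV01_pos[OF b]) auto
  \<comment> \<open>The first factor bounds the outer weight: \<open>t powr (- 1) * b t\<close> is
    almost decreasing and \<open>t powr (- 1)\<close> is below 4. The second bounds the inner norm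
    at \<open>1/4 < t\<close>.\<close>
  define k where "k = b (1/2) / (2 * C) * (c * (1/4) powr recip p)"
  have k: "0 < k" using b2 C c by (simp add: k_def)
  have "0 < ennreal (k * (1/2 - 1/4) powr recip r)" using k by simp
  also have "\<dots> = Lnorm r (1/4) (1/2) (\<lambda>_. ennreal k)"
    using k by (intro Lnorm_const[symmetric] r) auto
  also have "\<dots> \<le> Lnorm r (1/4) (1/2) (\<lambda>t. ?\<beta> t * ?I t)"
  proof (intro Lnorm_mono r borel_lebesgue_on borel_measurable_const)
    fix t :: real assume t: "1/4 < t" "t < 1/2"
    have "ennreal (c * (1/4) powr recip p) \<le> ennreal (c * t powr recip p)"
      using c t by (intro ennreal_leI mult_left_mono powr_mono2) auto
    also have "\<dots> \<le> Lnorm q (t / 2) t (\<lambda>w. ennreal (w powr (recip p - recip q)))"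
      using t by (intro c) auto
    also have "\<dots> \<le> Lnorm q 0 t (\<lambda>w. ennreal (w powr (recip p - recip q)))"
      using t by (intro Lnorm_subinterval q) auto
    also have "\<dots> \<le> ?I t"
    proof (intro Lnorm_mono q powr_Lnorm_measurable)
      fix u assume u: "0 < u" "u < t"
      have "1 \<le> u powr (- s)" using powr_mono2'[of "- s" u 1] u t s by simp
      then have "ennreal (u powr (recip p - recip q)) * 1 \<le> ennreal (u powr (recip p - recip q)) * rearr ?f u"
        using u t s by (intro mult_left_mono) (auto simp: rearr_powr)
      then show "ennreal (u powr (recip p - recip q)) \<le> ennreal (u powr (recip p - recip q)) * rearr ?f u"
        by simp
    qed
    finally have I: "ennreal (c * (1/4) powr recip p) \<le> ?I t" .
    have "(1/2) powr (- 1) * b (1/2) \<le> C * (t powr (- 1) * b t)"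
      using t by (intro C) auto
    also have "\<dots> \<le> C * (4 * b t)"
      using t C(1) SV01_pos[OF b, of t] by (intro mult_left_mono mult_right_mono) (auto simp: powr_minus field_simps)
    finally have "b (1/2) / (2 * C) \<le> b t"
      using C(1) by (simp add: powr_minus field_simps)
    also have "\<dots> = 1 * b t" by simp
    also have "\<dots> \<le> t powr (- recip r) * b t"
      using t SV01_pos[OF b, of t] powr_mono2'[of "- recip r" t 1] by (intro mult_right_mono) auto
    finally have "ennreal (b (1/2) / (2 * C)) \<le> ?\<beta> t" by (rule ennreal_leI)
    then have "ennreal (b (1/2) / (2 * C)) * ennreal (c * (1/4) powr recip p) \<le> ?\<beta> t * ?I t"
      using I by (rule mult_mono) auto
    then show "ennreal k \<le> ?\<beta> t * ?I t"
      using c unfolding k_def by (subst ennreal_mult'') auto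
  qed
  also have "\<dots> \<le> small_Lorentz_norm b p q r ?f"
    unfolding small_Lorentz_norm_def Bnorm_def by (intro Lnorm_subinterval r) auto
  finally show ?thesis .
qed

section \<open>Failure of the equivalences for the remaining exponents\<close>

lemma H_upper_powr:
  assumes W: "0 < W" "W < \<infinity>" and \<kappa>: "0 < \<kappa>" "\<kappa> \<le> recip U" and u: "0 < u" "u < 1"
  shows "H_upper U W (\<lambda>x. complex_of_real (x powr (- (recip U - \<kappa>)))) u =
    ennreal ((\<kappa> * enn2real W) powr (- recip W)) * rearr (\<lambda>x. complex_of_real (x powr (- (recip U - \<kappa>)))) u"
proof -
  let ?s = "recip U - \<kappa>"
  let ?f = "\<lambda>x. complex_of_real (x powr (- ?s))"
  obtain Q where Q: "0 < Q" "W = ennreal Q" "recip W = 1 / Q"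
    using W by (auto elim: expo_cases)
  have "Lnorm W 0 u (\<lambda>v. ennreal (v powr (recip U - recip W)) * rearr ?f v) =
      Lnorm W 0 u (\<lambda>v. ennreal (v powr (\<kappa> - recip W)))"
  proof (intro Lnorm_cong)
    fix v assume v: "0 < v" "v < u"
    then have "rearr ?f v = ennreal (v powr (- ?s))"
      using u \<kappa> by (intro rearr_powr) auto
    then show "ennreal (v powr (recip U - recip W)) * rearr ?f v = ennreal (v powr (\<kappa> - recip W))"
      using v by (simp flip: ennreal_mult' powr_add)
  qed
  also have "\<dots> = ennreal ((\<kappa> * Q) powr (- 1 / Q) * u powr \<kappa>)"
    unfolding Q(3) unfolding Q(2) using Q(1) \<kappa>(1) u(1) by (rule Lnorm_powr_lower_real)
  finally have "H_upper U W ?f u = ennreal ((\<kappa> * Q) powr (- 1 / Q) * (u powr (- recip U) * u powr \<kappa>))"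
    by (simp add: H_upper_def mult_ac flip: ennreal_mult')
  also have "u powr (- recip U) * u powr \<kappa> = u powr (- ?s)"
    using u by (simp flip: powr_add)
  finally show ?thesis
    using rearr_powr[of ?s u] u \<kappa> Q(1) unfolding Q(3) unfolding Q(2) by (simp add: ennreal_mult')
qed

lemma H_upper_not_equiv:
  assumes b: "b \<in> SV01" and q: "0 < q" and r: "0 < r" and W: "0 < W" "W < \<infinity>"
    and U: "0 < U" "U < \<infinity>" and le: "recip U \<le> recip p"
  shows "\<not> equiv_on M01 (small_Lorentz_norm b p q r) (\<lambda>f. Bnorm b p q r (H_upper U W f))"
proof
  assume "equiv_on M01 (small_Lorentz_norm b p q r) (\<lambda>f. Bnorm b p q r (H_upper U W f))"
  then obtain c where c: "0 < c"
    "\<And>f. f \<in> M01 \<Longrightarrow> ennreal c * Bnorm b p q r (H_upper U W f) \<le> small_Lorentz_norm b p q r f"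
    unfolding equiv_on_def by blast
  obtain Q where Q: "0 < Q" "W = ennreal Q" "recip W = 1 / Q"
    using W by (auto elim: expo_cases)
  have U': "0 < recip U" by (rule recip_pos[OF U])
  \<comment> \<open>The first bound keeps the power \<open>recip U - \<kappa>\<close> positive, and
    \<open>0 < \<kappa>\<close> keeps it below \<open>recip p\<close>; the second makes the
    eigenvalue at least \<open>2 / c\<close>, which contradicts the constant
    \<open>c\<close>.\<close>
  define \<kappa> where "\<kappa> = min (recip U / 2) ((c / 2) powr Q / Q)"
  have "\<kappa> \<le> recip U / 2" "\<kappa> \<le> (c / 2) powr Q / Q"
    unfolding \<kappa>_def by (rule min.cobounded1, rule min.cobounded2)
  moreover have "0 < \<kappa>"
    using U' Q(1) c(1) by (simp add: \<kappa>_def)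
  ultimately have \<kappa>: "0 < \<kappa>" "\<kappa> < recip U" "\<kappa> * Q \<le> (c / 2) powr Q"
    using U' Q(1) by (simp_all add: pos_le_divide_eq)
  define \<mu> where "\<mu> = (\<kappa> * Q) powr (- recip W)"
  have "((c / 2) powr Q) powr (- (1 / Q)) \<le> (\<kappa> * Q) powr (- (1 / Q))"
    using \<kappa> Q by (intro powr_mono2') auto
  moreover have "((c / 2) powr Q) powr (- (1 / Q)) = 2 / c"
    using Q(1) c(1) by (simp add: powr_powr powr_minus_divide)
  ultimately have "2 / c \<le> \<mu>"
    unfolding \<mu>_def Q(3) by simp
  then have \<mu>: "1 < c * \<mu>" using c(1) by (simp add: field_simps)
  let ?s = "recip U - \<kappa>"
  let ?f = "\<lambda>x. complex_of_real (x powr (- ?s))"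
  have s: "0 \<le> ?s" "?s < recip p" using \<kappa> le by auto
  let ?I = "\<lambda>t. Lnorm q 0 t (\<lambda>u. ennreal (u powr (recip p - recip q)) * rearr ?f u)"
  let ?N = "small_Lorentz_norm b p q r ?f"
  have N: "?N < top" "0 < ?N"
    by (intro small_Lorentz_norm_powr_finite small_Lorentz_norm_powr_pos b q r s)+
  have "Bnorm b p q r (H_upper U W ?f) = Bnorm b p q r (\<lambda>u. ennreal \<mu> * rearr ?f u)"
    unfolding Bnorm_def
  proof (intro Lnorm_cong arg_cong2[where f="(*)"] refl)
    fix u t :: real assume "0 < u" "u < t" "t < 1"
    then show "H_upper U W ?f u = ennreal \<mu> * rearr ?f u"
      using H_upper_powr[OF W \<kappa>(1) less_imp_le[OF \<kappa>(2)], of u] Q by (simp add: \<mu>_def)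
  qed
  also have "\<dots> = Lnorm r 0 1 (\<lambda>t. ennreal \<mu> * (ennreal (t powr (- recip r) * b t) * ?I t))"
    unfolding Bnorm_def
  proof (intro Lnorm_cong)
    fix t :: real
    have "Lnorm q 0 t (\<lambda>u. ennreal (u powr (recip p - recip q)) * (ennreal \<mu> * rearr ?f u)) =
        Lnorm q 0 t (\<lambda>u. ennreal \<mu> * (ennreal (u powr (recip p - recip q)) * rearr ?f u))"
      by (simp only: mult.left_commute)
    also have "\<dots> = ennreal \<mu> * ?I t"
      by (intro Lnorm_cmult q powr_mult_measurable borel_lebesgue_on rearr_borel)
    finally show "ennreal (t powr (- recip r) * b t) *
        Lnorm q 0 t (\<lambda>u. ennreal (u powr (recip p - recip q)) * (ennreal \<mu> * rearr ?f u)) =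
        ennreal \<mu> * (ennreal (t powr (- recip r) * b t) * ?I t)"
      by (simp only: mult.left_commute)
  qed
  also have "\<dots> = ennreal \<mu> * ?N"
    unfolding small_Lorentz_norm_def Bnorm_def
    by (intro Lnorm_cmult r SV01_weight_measurable b Lnorm_left_measurable q)
  finally have "ennreal (c * \<mu>) * ?N \<le> ?N"
    using c(2)[OF powr_complex_in_M01, of "- ?s"] c(1) by (simp add: ennreal_mult' mult.assoc)
  moreover have "1 * ?N < ennreal (c * \<mu>) * ?N"
    using N \<mu> by (intro ennreal_mult_strict_right_mono) (auto simp flip: ennreal_1 simp: ennreal_less_iff)
  ultimately show False by simp
qed

lemma H_lower_not_equiv:
  assumes b: "b \<in> SV01" and q: "0 < q" and r: "0 < r" and p: "0 < p" "p < \<infinity>" and W: "0 < W"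
    and inf: "Lnorm r 0 1 (\<lambda>t. ennreal (t powr (- recip r) * b t)) = \<infinity>"
    and le: "recip p \<le> recip V"
  shows "\<not> equiv_on M01 (small_Lorentz_norm b p q r) (\<lambda>f. Bnorm b p q r (H_lower V W f))"
proof
  assume "equiv_on M01 (small_Lorentz_norm b p q r) (\<lambda>f. Bnorm b p q r (H_lower V W f))"
  then obtain c where c: "0 < c"
    "\<And>f. f \<in> M01 \<Longrightarrow> ennreal c * Bnorm b p q r (H_lower V W f) \<le> small_Lorentz_norm b p q r f"
    unfolding equiv_on_def by blast
  \<comment> \<open>The constant 1, written as a power so that the facts about power functions apply
    with \<open>s = 0\<close>.\<close>
  let ?f = "\<lambda>x. complex_of_real (x powr (- 0))"
  have f: "rearr ?f v = 1" if "0 < v" "v < 1" for v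
    using rearr_powr[of 0 v] that by simp
  obtain c1 where c1: "0 < c1"
    "\<And>v. 0 < v \<Longrightarrow> ennreal (c1 * v powr recip V) \<le> Lnorm W (v / 2) v (\<lambda>w. ennreal (w powr (recip V - recip W)))"
    using Lnorm_powr_dyadic[OF W] by blast
  obtain c2 where c2: "0 < c2"
    "\<And>v. 0 < v \<Longrightarrow> ennreal (c2 * v powr 0) \<le> Lnorm q (v / 2) v (\<lambda>w. ennreal (w powr (0 - recip q)))"
    using Lnorm_powr_dyadic[OF q] by blast
  \<comment> \<open>For \<open>u < 1 / 2\<close> the range of the average contains (1/2,1), which
    contributes a fixed amount; the prefactor is at least \<open>u powr (- recip p)\<close> because
    \<open>u < 1\<close>.\<close>
  have H: "ennreal c1 * ennreal (u powr (- recip p)) \<le> H_lower V W ?f u" if u: "0 < u" "u < 1 / 2" for u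
  proof -
    have "ennreal (c1 * 1 powr recip V) \<le> Lnorm W (1 / 2) 1 (\<lambda>w. ennreal (w powr (recip V - recip W)))"
      by (intro c1) simp
    also have "\<dots> \<le> Lnorm W u 1 (\<lambda>w. ennreal (w powr (recip V - recip W)))"
      using u by (intro Lnorm_subinterval W) auto
    also have "\<dots> = Lnorm W u 1 (\<lambda>w. ennreal (w powr (recip V - recip W)) * rearr ?f w)"
      using u by (intro Lnorm_cong) (simp only: f less_trans[of 0 u] mult_1_right)
    finally have L: "ennreal c1 \<le> Lnorm W u 1 (\<lambda>w. ennreal (w powr (recip V - recip W)) * rearr ?f w)"
      by simp
    have "u powr (- recip p) \<le> u powr (- recip V)"
      using u le by (intro powr_mono') auto
    then show ?thesis
      using L unfolding H_lower_def by (subst mult.commute) (auto intro!: mult_mono ennreal_leI)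
  qed
  \<comment> \<open>The powers combine to the borderline weight \<open>u powr (- recip q)\<close>,
    whose norm over every dyadic block is at least \<open>c2\<close>. One block below
    \<open>t / 2\<close> therefore gives a bound free of \<open>t\<close>, and the outer norm
    inherits the divergence of the weight.\<close>
  have inner: "ennreal (c1 * c2) \<le> Lnorm q 0 t (\<lambda>u. ennreal (u powr (recip p - recip q)) * H_lower V W ?f u)"
    if t: "0 < t" "t < 1" for t
  proof -
    have "ennreal c1 * ennreal (c2 * (t / 2) powr 0) \<le>
        ennreal c1 * Lnorm q (t / 2 / 2) (t / 2) (\<lambda>u. ennreal (u powr (0 - recip q)))"
      using t by (intro mult_left_mono c2) auto
    also have "\<dots> \<le> ennreal c1 * Lnorm q 0 (t / 2) (\<lambda>u. ennreal (u powr (0 - recip q)))"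
      using t by (intro mult_left_mono Lnorm_subinterval q) auto
    also have "\<dots> = Lnorm q 0 (t / 2) (\<lambda>u. ennreal c1 * ennreal (u powr (0 - recip q)))"
      by (intro Lnorm_cmult[symmetric] q powr_Lnorm_measurable)
    also have "\<dots> \<le> Lnorm q 0 (t / 2) (\<lambda>u. ennreal (u powr (recip p - recip q)) * H_lower V W ?f u)"
    proof (intro Lnorm_mono q borel_measurable_times_ennreal powr_Lnorm_measurable borel_measurable_const)
      fix u assume u: "0 < u" "u < t / 2"
      have "u powr (0 - recip q) = u powr (recip p - recip q) * u powr (- recip p)"
        using u by (simp flip: powr_add)
      then have "ennreal c1 * ennreal (u powr (0 - recip q)) =
          ennreal (u powr (recip p - recip q)) * (ennreal c1 * ennreal (u powr (- recip p)))"
        by (simp add: ennreal_mult' mult_ac)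
      also have "\<dots> \<le> ennreal (u powr (recip p - recip q)) * H_lower V W ?f u"
        using u t by (intro mult_left_mono H) auto
      finally show "ennreal c1 * ennreal (u powr (0 - recip q)) \<le>
          ennreal (u powr (recip p - recip q)) * H_lower V W ?f u" .
    qed
    also have "\<dots> \<le> Lnorm q 0 t (\<lambda>u. ennreal (u powr (recip p - recip q)) * H_lower V W ?f u)"
      using t by (intro Lnorm_subinterval q) auto
    finally show ?thesis using t c1 by (simp add: ennreal_mult')
  qed
  have \<beta>: "(\<lambda>t. ennreal (t powr (- recip r) * b t)) \<in> borel_measurable (lebesgue_on {0<..<1})"
    by (intro measurable_compose[OF SV01_measurable] measurable_ennreal b)
  have "ennreal (c1 * c2) * Lnorm r 0 1 (\<lambda>t. ennreal (t powr (- recip r) * b t)) =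
      Lnorm r 0 1 (\<lambda>t. ennreal (c1 * c2) * ennreal (t powr (- recip r) * b t))"
    by (intro Lnorm_cmult[symmetric] r \<beta>)
  also have "\<dots> \<le> Bnorm b p q r (H_lower V W ?f)"
    unfolding Bnorm_def
  proof (intro Lnorm_mono r borel_measurable_times_ennreal \<beta> borel_measurable_const)
    fix t :: real assume "0 < t" "t < 1"
    then show "ennreal (c1 * c2) * ennreal (t powr (- recip r) * b t) \<le> ennreal (t powr (- recip r) * b t) *
        Lnorm q 0 t (\<lambda>u. ennreal (u powr (recip p - recip q)) * H_lower V W ?f u)"
      by (subst mult.commute) (intro mult_left_mono inner, auto)
  qed
  finally have "top \<le> Bnorm b p q r (H_lower V W ?f)"
    unfolding inf using c1 c2 by (simp add: ennreal_mult_top)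
  then have "Bnorm b p q r (H_lower V W ?f) = top" by (simp only: top_unique)
  then have "small_Lorentz_norm b p q r ?f = top"
    using c(2)[OF powr_complex_in_M01, of "- 0"] c(1) by (simp add: ennreal_mult_top top_unique)
  moreover have "small_Lorentz_norm b p q r ?f < top"
    by (intro small_Lorentz_norm_powr_finite b q r recip_pos p) simp
  ultimately show False by simp
qed

theorem theorem54:
  fixes p q r U V W :: ennreal and b :: "real \<Rightarrow> real"
  assumes "0 < p" "p < \<infinity>" and "0 < q" and "0 < r"
    and "b \<in> SV01"
    and "Lnorm r 0 1 (\<lambda>t. ennreal (t powr (- recip r) * b t)) = \<infinity>"
    and "0 < W" "W < \<infinity>" and "0 < U" "U < \<infinity>" and "0 < V"
  shows "(equiv_on M01 (small_Lorentz_norm b p q r) (\<lambda>f. Bnorm b p q r (H_upper U W f))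
            \<longleftrightarrow> p > U)
       \<and> (equiv_on M01 (small_Lorentz_norm b p q r) (\<lambda>f. Bnorm b p q r (H_lower V W f))
            \<longleftrightarrow> p < V)"
proof (intro conjI)
  have U: "U < p \<longleftrightarrow> recip p < recip U"
    using assms by (intro recip_less_iff[symmetric])
  show "equiv_on M01 (small_Lorentz_norm b p q r) (\<lambda>f. Bnorm b p q r (H_upper U W f)) \<longleftrightarrow> p > U"
    unfolding U using H_upper_equiv[of b q r W p U] H_upper_not_equiv[of b q r W U p] assms
    by (cases "recip p < recip U") (auto simp: not_less)
  \<comment> \<open>In terms of reciprocals, \<open>V = \<infinity>\<close> is just the value 0 and
    needs no separate treatment.\<close>
  have V: "p < V \<longleftrightarrow> recip V < recip p"
    using assms by (intro recip_less_iff[symmetric])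
  show "equiv_on M01 (small_Lorentz_norm b p q r) (\<lambda>f. Bnorm b p q r (H_lower V W f)) \<longleftrightarrow> p < V"
    unfolding V using H_lower_equiv[of b q r W V p] H_lower_not_equiv[of b q r p W V] assms
    by (cases "recip V < recip p") (auto simp: not_less)
qed

end
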